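(* Let $\mathbb{K}$ be a number field with ring of integers $\mathcal{O}_{\mathbb{K}}$. Every order $\mathcal{O}$ in $\mathbb{K}$ can be written as an intersection of irreducible orders in $\mathbb{K}$ whose conductors are pairwise coprime ideals of $\mathcal{O}_{\mathbb{K}}$, and this representation is unique. The index $[\mathcal{O}_{\mathbb{K}}:\mathcal{O}]$ is the product of the indices in $\mathcal{O}_{\mathbb{K}}$ of the irreducible orders occurring in this decomposition, and the conductor $c_{\mathcal{O}}$ is the product of their conductors. The representation is given by $$\mathcal{O}=\bigcap_{\rho\in S(\mathcal{O})}\bigl(\mathcal{O}_\rho\cap\mathcal{O}_{\mathbb{K}}\bigr),$$ where, for each $\rho\in S(\mathcal{O})$, the localization $\mathcal{O}_\rho$ equals the localization of the corresponding irreducible component $\mathcal{O}_\rho\cap\mathcal{O}_{\mathbb{K}}$ at its corresponding prime (the unique element of $S(\mathcal{O}_\rho\cap\mathcal{O}_{\mathbb{K}})$).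
   Context: An order in $\mathbb{K}$ is a subring of $\mathcal{O}_{\mathbb{K}}$ of full rank $[\mathbb{K}:\mathbb{Q}]$ over $\mathbb{Z}$ (so its fraction field is $\mathbb{K}$ and its integral closure is $\mathcal{O}_{\mathbb{K}}$). For an integral domain $R$, $M(R)$ is the set of nonzero prime ideals of $R$, and $S(R)=\{\rho\in M(R): R_\rho \text{ is not a discrete valuation ring}\}$. An integral domain $R$ whose fraction field is a number field is irreducible if $|S(R)|=1$; an irreducible order is an order that is irreducible. For an integral domain $R$ with fraction field $\mathbb{K}$ and integral closure $\overline{R}$ in $\mathbb{K}$, the conductor is $c_R=\{x\in\mathbb{K}: x\overline{R}\subseteq R\}$; for an order $\mathcal{O}$, $c_{\mathcal{O}}$ is an ideal of $\mathcal{O}_{\mathbb{K}}$ contained in $\mathcal{O}$. Two ideals $I,J$ of $\mathcal{O}_{\mathbb{K}}$ are coprime if $I+J=\mathcal{O}_{\mathbb{K}}$. All localizations are regarded as subrings of $\mathbb{K}$. For $\mathcal{O}=\mathcal{O}_{\mathbb{K}}$, where $S(\mathcal{O})=\emptyset$, the empty intersection is understood to be $\mathcal{O}_{\mathbb{K}}$; empty products are $1$ for indices and $\mathcal{O}_{\mathbb{K}}$ for ideals. *)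

theory Defs
  imports
    "HOL-Computational_Algebra.Polynomial"
    "HOL-Algebra.Algebraic_Closure_Type"
    "HOL-Algebra.Ring_Divisibility"
    "HOL-Algebra.Ideal_Product"
begin

text \<open>
  The ambient field \<open>\<bbbK>\<close> is a type of class \<^class>\<open>field_char_0\<close>; rings with
  fraction field \<open>\<bbbK>\<close> are sets of elements of that type; as structures they inherit their
  operations from \<open>\<bbbK>\<close>.
\<close>

definition number_field :: "'k::field_char_0 itself \<Rightarrow> bool" where
  "number_field _ \<longleftrightarrow>
     (\<exists>B. finite_dimensional_vector_space (\<lambda>(q::rat) (x::'k). of_rat q * x) B)"

definition field_degree :: "'k::field_char_0 itself \<Rightarrow> nat" where
  "field_degree _ = vector_space.dim (\<lambda>(q::rat) (x::'k). of_rat q * x) UNIV"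

abbreviation ring_on :: "'k::field_char_0 set \<Rightarrow> 'k ring" where
  "ring_on R \<equiv> ring_of_type_algebra\<lparr>carrier := R\<rparr>"

definition ring_of_integers :: "'k::field_char_0 set" (\<open>\<O>\<^sub>K\<close>) where
  "\<O>\<^sub>K = {x. algebraic_int x}"

text \<open>
  The rank over \<open>\<int>\<close> is the maximal size of a \<open>\<int>\<close>-linearly independent
  subset. In a number field these sizes are bounded by the degree, so the supremum is attained.
\<close>

definition int_rank :: "'k::field_char_0 set \<Rightarrow> nat" where
  "int_rank A =
     Sup (card ` {B. B \<subseteq> A \<and> finite B \<and> \<not> module.dependent (\<lambda>(n::int) (x::'k). of_int n * x) B})"

definition is_order :: "'k::field_char_0 set \<Rightarrow> bool" where
  "is_order R \<longleftrightarrow> subring R (ring_on UNIV) \<and> R \<subseteq> \<O>\<^sub>K \<and> int_rank R = field_degree TYPE('k)"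

definition nonzero_primes :: "'k::field_char_0 set \<Rightarrow> 'k set set" where
  "nonzero_primes R = {P. primeideal P (ring_on R) \<and> P \<noteq> {0}}"

definition localization :: "'k::field_char_0 set \<Rightarrow> 'k set \<Rightarrow> 'k set" where
  "localization R P = {a / s | a s. a \<in> R \<and> s \<in> R - P}"

text \<open>A principal ideal domain with exactly one nonzero prime ideal; this excludes fields.\<close>

definition discrete_valuation_ring :: "('a, 'b) ring_scheme \<Rightarrow> bool" where
  "discrete_valuation_ring A \<longleftrightarrow>
     principal_domain A \<and> (\<exists>!P. primeideal P A \<and> P \<noteq> {\<zero>\<^bsub>A\<^esub>})"

definition singular_primes :: "'k::field_char_0 set \<Rightarrow> 'k set set" where
  "singular_primes R =
     {P \<in> nonzero_primes R. \<not> discrete_valuation_ring (ring_on (localization R P))}"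

definition irreducible_order :: "'k::field_char_0 set \<Rightarrow> bool" where
  "irreducible_order R \<longleftrightarrow> is_order R \<and> card (singular_primes R) = 1"

definition integral_closure :: "'k::field_char_0 set \<Rightarrow> 'k set" where
  "integral_closure R =
     {x. \<exists>p. Polynomial.coeff p (Polynomial.degree p) = 1 \<and> (\<forall>i. Polynomial.coeff p i \<in> R) \<and> poly p x = 0}"

definition conductor :: "'k::field_char_0 set \<Rightarrow> 'k set" where
  "conductor R = {x. \<forall>y\<in>integral_closure R. x * y \<in> R}"

definition coprime_ideals :: "'k::field_char_0 set \<Rightarrow> 'k set \<Rightarrow> bool" where
  "coprime_ideals I J \<longleftrightarrow> I <+>\<^bsub>ring_on \<O>\<^sub>K\<^esub> J = \<O>\<^sub>K"

definition order_index :: "'k::field_char_0 set \<Rightarrow> nat" where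
  "order_index R = card (a_rcosets\<^bsub>ring_on \<O>\<^sub>K\<^esub> R)"

text \<open>
  The intersection with the ring of integers only matters for the empty family. A set of orders
  suffices in place of an indexed family: the conductor of an irreducible order is a proper ideal,
  so an order with a conductor coprime to itself cannot occur and hence no order is repeated.
\<close>

definition irreducible_decomposition :: "'k::field_char_0 set \<Rightarrow> 'k set set \<Rightarrow> bool" where
  "irreducible_decomposition R F \<longleftrightarrow>
     (\<forall>A\<in>F. irreducible_order A) \<and>
     pairwise (\<lambda>A B. coprime_ideals (conductor A) (conductor B)) F \<and>
     R = \<O>\<^sub>K \<inter> \<Inter>F"

definition local_component :: "'k::field_char_0 set \<Rightarrow> 'k set \<Rightarrow> 'k set" where
  "local_component R P = localization R P \<inter> \<O>\<^sub>K"

end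

theory Submission
  imports Defs "Jordan_Normal_Form.Schur_Decomposition"
begin

text \<open>
  The trace of multiplication by an algebraic integer is an integer, so the trace form bounds the
  denominators of \<open>\<O>\<^sub>K\<close>: every order \<open>R\<close> contains \<open>m\<O>\<^sub>K\<close> for some integer \<open>m \<noteq> 0\<close>, and
  \<open>\<O>\<^sub>K/m\<O>\<^sub>K\<close> is finite. Hence the conductor \<open>c\<close> of \<open>R\<close> is nonzero, and \<open>R\<^sub>P\<close> is a discrete
  valuation ring exactly if it contains \<open>\<O>\<^sub>K\<close>, that is, if \<open>c\<close> is not contained in \<open>P\<close>. The singular
  primes are therefore the primes of the finite ring \<open>R/c\<close>. Each of them has an idempotent \<open>e\<^sub>P\<close>
  of \<open>R/c\<close>, and \<open>R\<^sub>P \<inter> \<O>\<^sub>K = {x \<in> \<O>\<^sub>K. e\<^sub>P x \<in> R}\<close>. As \<open>1 - e\<^sub>P\<close> lies in the conductor of this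
  component and \<open>e\<^sub>P e\<^sub>Q \<in> c\<close> for \<open>P \<noteq> Q\<close>, the components are irreducible with coprime conductors
  and intersect in \<open>R\<close>. In any other decomposition, an element that is 1 modulo the conductor of
  one component \<open>A\<close> and 0 modulo all the others shows \<open>A = R\<^sub>P \<inter> \<O>\<^sub>K\<close>, where \<open>P\<close> is the contraction
  to \<open>R\<close> of the singular prime of \<open>A\<close>.
\<close>

text \<open>Counting takes the place of Noetherian arguments. A set closed under addition that
  contains \<open>N * \<O>\<^sub>K\<close> is a union of residue classes, and there are finitely
  many of these; so only finitely many ideals contain a given nonzero integer, and maximal ones
  exist. The same pigeonhole on the powers of an element gives inverses modulo nonzero primes and
  idempotents modulo \<open>c\<close>: if \<open>s ^ i * (1 - s ^ k)\<close> lies in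
  \<open>c\<close>, then \<open>s ^ n\<close> is idempotent modulo \<open>c\<close> as soon as
  \<open>k\<close> divides \<open>n\<close> and \<open>n \<ge> i\<close>. The step that is not
  counting is that \<open>R\<^sub>P\<close> is a discrete valuation ring once it contains
  \<open>\<O>\<^sub>K\<close>. No factorization of ideals enters: a quotient \<open>x\<close> of
  elements of \<open>R\<close> satisfies an integer polynomial with a coefficient that is a unit in
  \<open>R\<^sub>P\<close>, and this coefficient decides whether \<open>x\<close> or
  \<open>1 / x\<close> lies in \<open>R\<^sub>P\<close>. The product formulas are the Chinese
  remainder theorem: the conductor of an intersection is the intersection of the conductors, and
  coprimality turns that into a product.\<close>

interpretation int_mod: Modules.module "\<lambda>(n::int) (x::'k::field_char_0). of_int n * x"
  by unfold_locales (auto simp: algebra_simps)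

interpretation rat_vs: vector_space "\<lambda>(q::rat) (x::'k::field_char_0). of_rat q * x"
  by unfold_locales (auto simp: algebra_simps of_rat_add of_rat_mult)

section \<open>Subrings of the ambient field\<close>

locale field_subring =
  fixes R :: "'k::field_char_0 set"
  assumes one [simp, intro]: "1 \<in> R"
    and diff [intro]: "x \<in> R \<Longrightarrow> y \<in> R \<Longrightarrow> x - y \<in> R"
    and mult [intro]: "x \<in> R \<Longrightarrow> y \<in> R \<Longrightarrow> x * y \<in> R"
begin

lemma zero [simp, intro]: "0 \<in> R"
  using diff[OF one one] by simp

lemma neg [intro]: "x \<in> R \<Longrightarrow> - x \<in> R"
  using diff[OF zero] by fastforce

lemma add [intro]: "x \<in> R \<Longrightarrow> y \<in> R \<Longrightarrow> x + y \<in> R"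
  using diff[OF _ neg] by fastforce

lemma sum [intro]: "(\<And>i. i \<in> I \<Longrightarrow> f i \<in> R) \<Longrightarrow> sum f I \<in> R"
  by (induction I rule: infinite_finite_induct) auto

lemma prod [intro]: "(\<And>i. i \<in> I \<Longrightarrow> f i \<in> R) \<Longrightarrow> prod f I \<in> R"
  by (induction I rule: infinite_finite_induct) auto

lemma power [intro]: "x \<in> R \<Longrightarrow> x ^ n \<in> R"
  by (induction n) auto

lemma of_nat [simp, intro]: "of_nat n \<in> R"
  by (induction n) auto

lemma of_int [simp, intro]: "of_int n \<in> R"
  by (cases n) auto

lemma int_span_subset: "S \<subseteq> R \<Longrightarrow> int_mod.span S \<subseteq> R"
  by (rule int_mod.span_minimal) (auto simp: int_mod.subspace_def)

end

section \<open>Algebraic integers\<close>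

text \<open>Multiplication by \<open>x\<close> is an integer matrix on the generators, and the
  vector of the generators is an eigenvector for \<open>x\<close>; it is nonzero because of
  \<open>s\<close>. So \<open>x\<close> is a root of the characteristic polynomial, which is monic
  with integer coefficients. The generators may be linearly dependent.\<close>

lemma algebraic_int_if_stable_module:
  fixes x :: "'k::field_char_0"
  assumes fin: "finite S" and ne: "s \<in> S" "s \<noteq> 0"
    and stable: "\<And>s. s \<in> S \<Longrightarrow> x * s \<in> int_mod.span S"
  shows "algebraic_int x"
proof -
  obtain n e where e: "bij_betw e {..<n::nat} S"
    using ex_bij_betw_nat_finite[OF fin] by (auto simp: atLeast0LessThan)
  have "\<exists>f. x * e i = (\<Sum>j<n. of_int (f j) * e j)" if "i < n" for i
  proof -
    have "e i \<in> S" using e that by (auto simp: bij_betw_def)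
    then obtain u where "x * e i = (\<Sum>v\<in>S. of_int (u v) * v)"
      using stable[of "e i"] int_mod.span_finite[OF fin] by auto
    also have "\<dots> = (\<Sum>j<n. of_int (u (e j)) * e j)"
      by (rule sum.reindex_bij_betw[OF e, symmetric])
    finally show ?thesis by (rule exI[of _ "\<lambda>j. u (e j)"])
  qed
  then obtain A where A: "\<And>i. i < n \<Longrightarrow> x * e i = (\<Sum>j<n. of_int (A i j) * e j)"
    by metis
  define M where "M = mat n n (\<lambda>(i,j). A i j)"
  define v where "v = vec n e"
  have M: "M \<in> carrier_mat n n" by (simp add: M_def)
  have M': "map_mat (of_int :: int \<Rightarrow> 'k) M \<in> carrier_mat n n" using M by simp
  obtain i where i: "i < n" "e i = s" using e ne by (auto simp: bij_betw_def)
  have "v \<noteq> 0\<^sub>v n"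
  proof
    assume "v = 0\<^sub>v n"
    then have "v $ i = 0" using i by simp
    then show False using i ne by (simp add: v_def)
  qed
  moreover have "map_mat of_int M *\<^sub>v v = x \<cdot>\<^sub>v v"
    by (rule eq_vecI) (auto simp: M_def v_def scalar_prod_def A atLeast0LessThan)
  ultimately have "eigenvector (map_mat of_int M) v x"
    using M by (auto simp: eigenvector_def v_def)
  then have "poly (char_poly (map_mat of_int M)) x = 0"
    using eigenvalue_root_char_poly[OF M'] by (auto simp: eigenvalue_def)
  then have "poly (map_poly of_int (char_poly M)) x = 0"
    by (simp only: of_int_hom.char_poly_hom[OF M])
  moreover have "lead_coeff (char_poly M) = 1"
    using degree_monic_char_poly[OF M] by simp
  ultimately show ?thesis
    unfolding algebraic_int_altdef_ipoly by blast
qed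

text \<open>Rings with finitely generated additive group consist of algebraic integers and survive
  the adjunction of an integral element. Finitely many algebraic integers therefore lie in one such
  ring, which gives closure of \<open>\<O>\<^sub>K\<close> under the ring operations.\<close>

definition module_finite :: "'k::field_char_0 set \<Rightarrow> bool" where
  "module_finite A \<longleftrightarrow> field_subring A \<and> (\<exists>S. finite S \<and> A = int_mod.span S)"

lemma module_finite_algebraic_int:
  assumes "module_finite A" "x \<in> A"
  shows "algebraic_int x"
proof -
  from assms obtain S where S: "finite S" "A = int_mod.span S"
    by (auto simp: module_finite_def)
  interpret field_subring A using assms by (simp add: module_finite_def)
  have "\<not> S \<subseteq> {0}"
  proof
    assume "S \<subseteq> {0}"
    then have "A \<subseteq> {0}"
      unfolding S by (intro int_mod.span_minimal) (auto simp: int_mod.subspace_def)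
    then have "(1::'a) \<in> {0}" using one by blast
    then show False by simp
  qed
  then obtain s where "s \<in> S" "s \<noteq> 0" by blast
  moreover have "x * s \<in> int_mod.span S" if "s \<in> S" for s
    using that assms(2) int_mod.span_base[OF that] mult S by blast
  ultimately show ?thesis
    using algebraic_int_if_stable_module[OF S(1)] by blast
qed

lemma module_finite_int: "module_finite (\<int> :: 'k::field_char_0 set)"
proof -
  have "\<int> = int_mod.span {1::'k}"
    by (auto simp: int_mod.span_singleton Ints_def)
  moreover have "field_subring (\<int> :: 'k set)"
    by unfold_locales auto
  ultimately show ?thesis
    unfolding module_finite_def by blast
qed

text \<open>The products \<open>s * x ^ i\<close> with \<open>i\<close> below the degree generate
  the new ring, since the monic relation rewrites \<open>x ^ d\<close>. Stability of the span is
  shown under \<open>x\<close>, under \<open>A\<close> and finally under itself. The coefficients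
  range over \<open>A\<close> and not just over the integers, so that the lemma also yields
  transitivity of integrality.\<close>

lemma module_finite_adjoin:
  fixes x :: "'k::field_char_0"
  assumes A: "module_finite A"
    and p: "Polynomial.coeff p (Polynomial.degree p) = 1" "\<And>i. Polynomial.coeff p i \<in> A" "poly p x = 0"
  shows "\<exists>B. module_finite B \<and> A \<subseteq> B \<and> x \<in> B"
proof -
  obtain S where S: "finite S" "A = int_mod.span S"
    using A by (auto simp: module_finite_def)
  interpret A: field_subring A using A by (simp add: module_finite_def)
  define d where "d = Polynomial.degree p"
  have dpos: "d > 0"
  proof (rule ccontr)
    assume "\<not> d > 0"
    then obtain c where "p = [:c:]" by (auto simp: d_def elim: degree_eq_zeroE)
    then show False using p(1,3) by auto
  qed
  define T where "T = (\<lambda>(s,i). s * x ^ i) ` (S \<times> {..<d})"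
  define B where "B = int_mod.span T"
  have B_add: "a + b \<in> B" and B_diff: "a - b \<in> B" if "a \<in> B" "b \<in> B" for a b
    using that unfolding B_def by (auto intro: int_mod.span_add int_mod.span_diff)
  have B_sum: "sum f I \<in> B" if "\<And>i. i \<in> I \<Longrightarrow> f i \<in> B" for f :: "nat \<Rightarrow> 'k" and I
    using that unfolding B_def by (rule int_mod.span_sum)
  have B0: "0 \<in> B" unfolding B_def by (rule int_mod.span_zero)
  have Ax: "a * x ^ i \<in> B" if "a \<in> A" "i < d" for a i
  proof -
    have "a \<in> int_mod.span S" using that S by simp
    then show ?thesis
    proof (induction rule: int_mod.span_induct_alt)
      case base then show ?case by (simp add: B0)
    next
      case (step c s a)
      have "s * x ^ i \<in> T" using step that by (auto simp: T_def)
      then have "of_int c * (s * x ^ i) \<in> B"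
        unfolding B_def by (intro int_mod.span_scale int_mod.span_base)
      then have "of_int c * (s * x ^ i) + a * x ^ i \<in> B" using step(2) by (rule B_add)
      then show ?case by (simp add: algebra_simps)
    qed
  qed
  have xd: "x ^ d = - (\<Sum>i<d. Polynomial.coeff p i * x ^ i)"
  proof -
    have "0 = (\<Sum>i\<le>d. Polynomial.coeff p i * x ^ i)"
      using p(3) by (simp add: poly_altdef d_def)
    also have "{..d} = insert d {..<d}" by auto
    finally show ?thesis using p(1) by (simp add: d_def eq_neg_iff_add_eq_0)
  qed
  have Bx: "b * x \<in> B" if "b \<in> B" for b
    using that unfolding B_def
  proof (induction rule: int_mod.span_induct_alt)
    case base then show ?case using B0 by (simp add: B_def)
  next
    case (step c t b)
    then obtain s i where t: "t = s * x ^ i" "s \<in> S" "i < d" by (auto simp: T_def)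
    have sA: "s \<in> A" using t S by (simp add: int_mod.span_base)
    have "t * x \<in> B"
    proof (cases "Suc i < d")
      case True
      then show ?thesis using Ax[OF sA True] t by (simp add: mult_ac)
    next
      case False
      with t have "t * x = s * x ^ d"
        by (metis Suc_lessI mult.assoc power_Suc2)
      also have "\<dots> = 0 - (\<Sum>i<d. (s * Polynomial.coeff p i) * x ^ i)"
        unfolding xd by (simp add: sum_distrib_left mult_ac)
      also have "\<dots> \<in> B"
        using sA p(2) by (intro B_diff B0 B_sum Ax) auto
      finally show ?thesis .
    qed
    then have "of_int c * (t * x) \<in> B" unfolding B_def by (rule int_mod.span_scale)
    moreover have "b * x \<in> B" using step by (simp add: B_def)
    ultimately have "of_int c * (t * x) + b * x \<in> B" by (rule B_add)
    then show ?case by (simp add: algebra_simps B_def)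
  qed
  have Bxi: "b * x ^ i \<in> B" if "b \<in> B" for b i
    using that by (induction i) (auto simp: mult.assoc[symmetric] power_Suc2 simp del: power_Suc intro: Bx)
  have Ba: "b * a \<in> B" if "b \<in> B" "a \<in> A" for b a
    using that(1) unfolding B_def
  proof (induction rule: int_mod.span_induct_alt)
    case base then show ?case using B0 by (simp add: B_def)
  next
    case (step c t b)
    then obtain s i where t: "t = s * x ^ i" "s \<in> S" "i < d" by (auto simp: T_def)
    have sA: "s \<in> A" using t S by (simp add: int_mod.span_base)
    have "(of_int c * (s * a)) * x ^ i \<in> B"
      using sA that t by (intro Ax) auto
    moreover have "b * a \<in> B" using step by (simp add: B_def)
    ultimately have "(of_int c * (s * a)) * x ^ i + b * a \<in> B" by (rule B_add)
    then show ?case by (simp add: algebra_simps B_def t)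
  qed
  have BB: "b * c \<in> B" if "b \<in> B" "c \<in> B" for b c
    using that(2) unfolding B_def
  proof (induction rule: int_mod.span_induct_alt)
    case base then show ?case using B0 by (simp add: B_def)
  next
    case (step k t c)
    then obtain s i where t: "t = s * x ^ i" "s \<in> S" "i < d" by (auto simp: T_def)
    have sA: "s \<in> A" using t S by (simp add: int_mod.span_base)
    have "b * (of_int k * s) * x ^ i \<in> B"
      using sA that by (intro Bxi Ba) auto
    moreover have "b * c \<in> B" using step by (simp add: B_def)
    ultimately have "b * (of_int k * s) * x ^ i + b * c \<in> B" by (rule B_add)
    then show ?case by (simp add: algebra_simps B_def t)
  qed
  have AB: "A \<subseteq> B" using Ax[OF _ dpos] by (metis diff_0_right mult.right_neutral power_0 subsetI neq0_conv dpos Ax)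
  have "field_subring B"
    using AB B_diff BB by unfold_locales auto
  moreover have "finite T" by (simp add: T_def S)
  ultimately have "module_finite B" unfolding module_finite_def B_def by blast
  moreover have "x \<in> B" using Bx[of 1] AB by auto
  ultimately show ?thesis using AB by blast
qed

lemma module_finite_adjoin_algebraic_int:
  assumes A: "module_finite A" and x: "algebraic_int x"
  shows "\<exists>B. module_finite B \<and> A \<subseteq> B \<and> x \<in> B"
proof -
  interpret field_subring A using A by (simp add: module_finite_def)
  have "\<int> \<subseteq> A" by (auto simp: Ints_def)
  moreover obtain p where "Polynomial.coeff p (Polynomial.degree p) = 1"
      "\<And>i. Polynomial.coeff p i \<in> \<int>" "poly p x = 0"
    using x by (auto simp: algebraic_int.simps)
  ultimately show ?thesis
    using module_finite_adjoin[OF A, of p x] by blast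
qed

lemma module_finite_superset_algebraic_ints:
  fixes Y :: "'k::field_char_0 set"
  assumes "finite Y" "\<And>x. x \<in> Y \<Longrightarrow> algebraic_int x"
  shows "\<exists>B. module_finite B \<and> Y \<subseteq> B"
  using assms
proof (induction Y rule: finite_induct)
  case empty
  then show ?case using module_finite_int by blast
next
  case (insert x Y)
  then obtain B where "module_finite B" "Y \<subseteq> B" by auto
  moreover from this obtain C where "module_finite C" "B \<subseteq> C" "x \<in> C"
    using module_finite_adjoin_algebraic_int insert by blast
  ultimately show ?case by (intro exI[of _ C]) auto
qed

lemma field_subring_ring_of_integers: "field_subring (\<O>\<^sub>K :: 'k::field_char_0 set)"
proof
  show "1 \<in> (\<O>\<^sub>K :: 'k set)" by (auto simp: ring_of_integers_def)
next
  fix x y :: 'k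
  assume "x \<in> \<O>\<^sub>K" "y \<in> \<O>\<^sub>K"
  then obtain B where B: "module_finite B" "{x,y} \<subseteq> B"
    using module_finite_superset_algebraic_ints[of "{x,y}"] by (auto simp: ring_of_integers_def)
  interpret field_subring B using B by (simp add: module_finite_def)
  show "x - y \<in> \<O>\<^sub>K" "x * y \<in> \<O>\<^sub>K"
    using B module_finite_algebraic_int[OF B(1)] by (auto simp: ring_of_integers_def)
qed

interpretation integers: field_subring "\<O>\<^sub>K"
  by (rule field_subring_ring_of_integers)

text \<open>The finitely many coefficients lie in a ring with finitely generated additive group, and
  \<open>x\<close> can be adjoined to it.\<close>

lemma ring_of_integers_integrally_closed:
  fixes x :: "'k::field_char_0"
  assumes p: "Polynomial.coeff p (Polynomial.degree p) = 1" "\<And>i. Polynomial.coeff p i \<in> \<O>\<^sub>K" "poly p x = 0"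
  shows "x \<in> \<O>\<^sub>K"
proof -
  obtain A where A: "module_finite A" "Polynomial.coeff p ` {..Polynomial.degree p} \<subseteq> A"
    using module_finite_superset_algebraic_ints[of "Polynomial.coeff p ` {..Polynomial.degree p}"] p(2)
    by (auto simp: ring_of_integers_def)
  interpret A: field_subring A using A by (simp add: module_finite_def)
  have "Polynomial.coeff p i \<in> A" for i
    using A(2) by (cases "i \<le> Polynomial.degree p") (auto simp: coeff_eq_0)
  then obtain B where "module_finite B" "x \<in> B"
    using module_finite_adjoin[OF A(1) p(1) _ p(3)] by blast
  then show ?thesis
    using module_finite_algebraic_int by (auto simp: ring_of_integers_def)
qed

section \<open>The trace and finiteness of quotients of the ring of integers\<close>

lemma common_denominator:
  fixes u :: "'a \<Rightarrow> rat"
  assumes "finite T"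
  shows "\<exists>D::int. D \<noteq> 0 \<and> (\<forall>v\<in>T. \<exists>k. of_int D * u v = of_int k)"
  using assms
proof (induction T rule: finite_induct)
  case empty
  then show ?case by (intro exI[of _ 1]) auto
next
  case (insert a T)
  then obtain D :: int where D: "D \<noteq> 0" "\<forall>v\<in>T. \<exists>k. of_int D * u v = of_int k" by blast
  obtain p q where "quotient_of (u a) = (p, q)" by fastforce
  then have q: "u a = of_int p / of_int q" "q > 0"
    by (auto dest: quotient_of_div quotient_of_denom_pos)
  then have ua: "of_int q * u a = of_int p" by simp
  have "of_int (D * q) * u a = of_int (D * p)"
    using ua by (simp add: mult.assoc)
  moreover have "\<exists>k. of_int (D * q) * u v = of_int k" if "v \<in> T" for v
  proof -
    obtain k where "of_int D * u v = of_int k" using D(2) \<open>v \<in> T\<close> by blast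
    then have "of_int (D * q) * u v = of_int (q * k)" by (simp add: mult.assoc mult.left_commute[of _ "of_int q"])
    then show ?thesis by blast
  qed
  ultimately have "\<forall>v\<in>insert a T. \<exists>k. of_int (D * q) * u v = of_int k" by blast
  then show ?case using D(1) q(2) by (intro exI[of _ "D * q"]) simp
qed

text \<open>A rational relation becomes an integer one after multiplication by a common denominator.
  This turns the rank over \<int> into a matter of rational dimension.\<close>

lemma independent_rat_iff_int:
  fixes B :: "'k::field_char_0 set"
  shows "rat_vs.independent B \<longleftrightarrow> int_mod.independent B"
proof
  assume L: "rat_vs.independent B"
  show "int_mod.independent B"
    unfolding int_mod.independent_explicit_module
  proof (intro allI impI)
    fix t u v
    assume "finite t" "t \<subseteq> B" "(\<Sum>v\<in>t. of_int (u v) * v) = 0" "v \<in> t"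
    then show "u v = 0"
      using L[unfolded rat_vs.independent_explicit_module, rule_format, of t "\<lambda>v. of_int (u v)" v]
      by simp
  qed
next
  assume R: "int_mod.independent B"
  show "rat_vs.independent B"
    unfolding rat_vs.independent_explicit_module
  proof (intro allI impI)
    fix t u v
    assume *: "finite t" "t \<subseteq> B" "(\<Sum>v\<in>t. of_rat (u v) * v) = 0" "v \<in> t"
    obtain D :: int where D: "D \<noteq> 0" "\<forall>v\<in>t. \<exists>k. of_int D * u v = of_int k"
      using common_denominator[OF *(1)] by blast
    then obtain k where k: "\<And>v. v \<in> t \<Longrightarrow> of_int D * u v = of_int (k v)" by metis
    have "(\<Sum>v\<in>t. of_int (k v) * v) = (\<Sum>v\<in>t. of_rat (of_int D * u v) * v)"
      by (intro sum.cong refl) (simp add: k)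
    also have "\<dots> = of_int D * (\<Sum>v\<in>t. of_rat (u v) * v)"
      by (simp add: of_rat_mult sum_distrib_left mult_ac)
    finally have "(\<Sum>v\<in>t. of_int (k v) * v) = 0" using * by simp
    then have "k v = 0"
      using R[unfolded int_mod.independent_explicit_module, rule_format, of t k v] * by simp
    then show "u v = 0" using k[OF *(4)] D by simp
  qed
qed

definition rat_basis :: "'k::field_char_0 set \<Rightarrow> bool" where
  "rat_basis B \<longleftrightarrow> finite B \<and> rat_vs.independent B \<and> rat_vs.span B = UNIV"

text \<open>Sizes of independent subsets are bounded by the degree, so the supremum is a maximum; an
  independent set of maximal possible size spans. What later proofs take from the full rank of an
  order is the rational basis inside it.\<close>

lemma int_rank_eq_field_degree_iff:
  fixes A :: "'k::field_char_0 set"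
  assumes "number_field TYPE('k)"
  shows "int_rank A = field_degree TYPE('k) \<longleftrightarrow> (\<exists>B\<subseteq>A. rat_basis B)"
proof -
  obtain E :: "'k set" where "finite_dimensional_vector_space (\<lambda>(q::rat) (x::'k). of_rat q * x) E"
    using assms unfolding number_field_def by blast
  then interpret E: finite_dimensional_vector_space "\<lambda>(q::rat) (x::'k). of_rat q * x" E .
  define S where "S = {B. B \<subseteq> A \<and> finite B \<and> int_mod.independent B}"
  define d where "d = field_degree TYPE('k)"
  have d: "d = rat_vs.dim (UNIV :: 'k set)" by (simp add: d_def field_degree_def)
  have rank: "int_rank A = Sup (card ` S)" by (simp add: int_rank_def S_def)
  have bound: "card B \<le> d" if "B \<in> S" for B
    using that E.independent_card_le_dim[of B UNIV] unfolding d S_def independent_rat_iff_int by blast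
  have fin: "finite (card ` S)" by (rule finite_subset[of _ "{..d}"]) (use bound in auto)
  have "{} \<in> S" by (simp add: S_def int_mod.independent_empty)
  then have ne: "card ` S \<noteq> {}" by blast
  have rank': "int_rank A = Max (card ` S)" using ne fin unfolding rank
    by (simp add: Sup_nat_def)
  have span: "rat_vs.span B = UNIV" if "B \<in> S" "card B = d" for B
  proof -
    have "UNIV \<subseteq> rat_vs.span B"
      using that unfolding S_def d
      by (intro E.card_ge_dim_independent) (auto simp: independent_rat_iff_int)
    then show ?thesis by blast
  qed
  show ?thesis
  proof
    assume "int_rank A = field_degree TYPE('k)"
    then have "d \<in> card ` S" using Max_in[OF fin ne] rank' d_def by simp
    then obtain B where "B \<in> S" "card B = d" by blast
    then show "\<exists>B\<subseteq>A. rat_basis B"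
      using span[of B] unfolding rat_basis_def S_def independent_rat_iff_int by blast
  next
    assume "\<exists>B\<subseteq>A. rat_basis B"
    then obtain B where B: "B \<subseteq> A" "finite B" "rat_vs.independent B" "rat_vs.span B = UNIV"
      by (auto simp: rat_basis_def)
    then have "card B = d" unfolding d
      by (metis rat_vs.dim_span rat_vs.dim_eq_card_independent)
    moreover have "B \<in> S" using B by (simp add: S_def independent_rat_iff_int)
    ultimately have "Max (card ` S) = d"
      using fin bound by (intro Max_eqI) auto
    then show "int_rank A = field_degree TYPE('k)" by (simp add: rank' d_def)
  qed
qed

text \<open>Additivity makes \<open>l\<close> linear over \<int>, so applying \<open>l\<close> to
  \<open>p(x) * z = 0\<close> gives \<open>p(a) * l z = 0\<close> for the monic integer polynomial
  \<open>p\<close> of \<open>x\<close>. The target is a second field, because the eigenvalues live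
  in the complex numbers and no embedding of the number field is chosen.\<close>

lemma algebraic_int_if_eigenvalue_of_functional:
  fixes l :: "'k::field_char_0 \<Rightarrow> 'l::field_char_0"
  assumes l: "\<And>x y. l (x + y) = l x + l y" and eig: "\<And>y. l (x * y) = a * l y"
    and ne: "l z \<noteq> 0" and x: "algebraic_int x"
  shows "algebraic_int a"
proof -
  have l0: "l 0 = 0" using l[of 0 0] by simp
  have lm: "l (- y) = - l y" for y using l[of y "- y"] l0 by (simp add: eq_neg_iff_add_eq_0 add.commute)
  have ln: "l (of_nat n * y) = of_nat n * l y" for n y
    by (induction n) (auto simp: l0 l algebra_simps)
  have li: "l (of_int n * y) = of_int n * l y" for n y
    using ln lm by (cases n) (auto simp del: of_nat_Suc)
  have lpow: "l (x ^ k * y) = a ^ k * l y" for k y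
    by (induction k) (auto simp: eig mult.assoc)
  have lsum: "l (sum f I) = (\<Sum>i\<in>I. l (f i))" for f and I :: "nat set"
    by (induction I rule: infinite_finite_induct) (auto simp: l l0)
  obtain p where p: "poly (map_poly of_int p) x = 0" "lead_coeff p = 1"
    using x unfolding algebraic_int_altdef_ipoly by blast
  have pe: "poly (map_poly of_int p) y = (\<Sum>k\<le>Polynomial.degree p. of_int (Polynomial.coeff p k) * y ^ k)"
    for y :: "'a::field_char_0"
    by (simp add: poly_altdef degree_map_poly coeff_map_poly)
  have "0 = l (poly (map_poly of_int p) x * z)" using p l0 by simp
  also have "\<dots> = (\<Sum>k\<le>Polynomial.degree p. l (of_int (Polynomial.coeff p k) * (x ^ k * z)))"
    by (simp add: pe sum_distrib_right lsum mult.assoc)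
  also have "\<dots> = poly (map_poly of_int p) a * l z"
    unfolding pe by (simp add: li lpow sum_distrib_right mult.assoc)
  finally have "poly (map_poly of_int p) a = 0" using ne by simp
  then show ?thesis using p(2) unfolding algebraic_int_altdef_ipoly by blast
qed

lemma sum_diag_mult_commute:
  fixes A C :: "'a::comm_ring_1 mat"
  assumes "A \<in> carrier_mat n n" "C \<in> carrier_mat n n"
  shows "(\<Sum>i<n. (A * C) $$ (i,i)) = (\<Sum>i<n. (C * A) $$ (i,i))"
proof -
  have "(\<Sum>i<n. (A * C) $$ (i,i)) = (\<Sum>i<n. \<Sum>j<n. A $$ (i,j) * C $$ (j,i))"
    using assms by (intro sum.cong refl) (auto simp: scalar_prod_def atLeast0LessThan)
  also have "\<dots> = (\<Sum>j<n. \<Sum>i<n. C $$ (j,i) * A $$ (i,j))"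
    by (subst sum.swap) (simp add: mult.commute)
  also have "\<dots> = (\<Sum>i<n. (C * A) $$ (i,i))"
    using assms by (intro sum.cong refl) (auto simp: scalar_prod_def atLeast0LessThan)
  finally show ?thesis .
qed

text \<open>Schur decomposition: the matrix is similar to one whose diagonal lists the roots of the
  characteristic polynomial, and the trace is invariant under similarity.\<close>

lemma sum_diag_eq_sum_eigenvalues:
  fixes A :: "complex mat"
  assumes A: "A \<in> carrier_mat n n"
  obtains es where "(\<Sum>i<n. A $$ (i,i)) = sum_list es" "\<And>a. a \<in> set es \<Longrightarrow> eigenvalue A a"
proof -
  obtain es where es: "char_poly A = (\<Prod>a\<leftarrow>es. [:- a, 1:])"
    using char_poly_factorized[OF A] by blast
  obtain C P Q where "schur_decomposition A es = (C, P, Q)"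
    by (cases "schur_decomposition A es") auto
  then have "similar_mat_wit A C P Q" and d: "diag_mat C = es"
    using schur_decomposition[OF A es] by auto
  then have m: "{A, C, P, Q} \<subseteq> carrier_mat n n" "Q * P = 1\<^sub>m n" "A = P * C * Q"
    using A unfolding similar_mat_wit_def Let_def by auto
  then have m': "C \<in> carrier_mat n n" "P \<in> carrier_mat n n" "Q \<in> carrier_mat n n" by auto
  have "(\<Sum>i<n. A $$ (i,i)) = (\<Sum>i<n. (Q * (P * C)) $$ (i,i))"
    using sum_diag_mult_commute[of "P * C" n Q] m' m(3) by simp
  also have "Q * (P * C) = C" using m' m(2) by (simp add: assoc_mult_mat[symmetric, of _ n n _ n _ n])
  also have "(\<Sum>i<n. C $$ (i,i)) = sum_list es"
    using m'(1) unfolding d[symmetric] diag_mat_def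
    by (simp add: sum_list_distinct_conv_sum_set atLeast0LessThan)
  finally have "(\<Sum>i<n. A $$ (i,i)) = sum_list es" .
  moreover have "eigenvalue A a" if "a \<in> set es" for a
    using that unfolding eigenvalue_root_char_poly[OF A] es poly_prod_list prod_list_zero_iff by auto
  ultimately show ?thesis using that by blast
qed

section \<open>The trace form of a rational basis and its dual lattice\<close>

context
  fixes B :: "'k::field_char_0 set"
  assumes B: "rat_basis B"
begin

definition field_trace :: "'k \<Rightarrow> rat" where
  "field_trace x = (\<Sum>v\<in>B. rat_vs.representation B (x * v) v)"

private lemma finB: "finite B" and indB: "rat_vs.independent B" and spanB: "rat_vs.span B = UNIV"
  using B by (auto simp: rat_basis_def)

private abbreviation "rep \<equiv> rat_vs.representation B"

private lemma rep_add: "rep (x + y) v = rep x v + rep y v"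
  by (simp add: rat_vs.representation_add indB spanB)

private lemma rep_scale: "rep (of_rat q * x) v = q * rep x v"
  using rat_vs.representation_scale[OF indB, of x q] by (simp add: spanB)

private lemma rep_sum: "rep (sum f I) v = (\<Sum>i\<in>I. rep (f i) v)"
  using rat_vs.representation_sum[OF indB, of I f] by (simp add: spanB)

private lemma rep_basis: "u \<in> B \<Longrightarrow> rep u v = (if v = u then 1 else 0)"
  by (simp add: rat_vs.representation_basis indB)

private lemma sum_rep: "(\<Sum>v\<in>B. of_rat (rep x v) * v) = x"
  using rat_vs.sum_representation_eq[OF indB, of x B] finB by (simp add: spanB)

lemma field_trace_add: "field_trace (x + y) = field_trace x + field_trace y"
  by (simp add: field_trace_def distrib_right rep_add sum.distrib)

lemma field_trace_scale: "field_trace (of_rat q * x) = q * field_trace x"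
  by (simp add: field_trace_def mult.assoc rep_scale sum_distrib_left)

text \<open>The value is the degree, which is nonzero in characteristic 0. The nondegeneracy of the
  trace form rests on this.\<close>

lemma field_trace_one_nonzero: "field_trace 1 \<noteq> 0"
proof -
  have "field_trace 1 = of_nat (card B)"
    by (simp add: field_trace_def rep_basis)
  moreover have "B \<noteq> {}"
  proof
    assume "B = {}"
    then have "(1::'k) \<in> {0}" using spanB by (metis UNIV_I rat_vs.span_empty)
    then show False by simp
  qed
  ultimately show ?thesis using finB by simp
qed

text \<open>
  An eigenvector of the transposed multiplication matrix is a functional \<open>l\<close> with
  \<open>l (x * y) = a * l y\<close>, so every eigenvalue \<open>a\<close> is a root of each integer polynomial of \<open>x\<close>.
\<close>

lemma field_trace_int:
  assumes x: "algebraic_int x"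
  shows "field_trace x \<in> \<int>"
proof -
  obtain n b where b: "bij_betw b {..<n::nat} B"
    using ex_bij_betw_nat_finite[OF finB] by (auto simp: atLeast0LessThan)
  have bB: "b i \<in> B" if "i < n" for i using b that by (auto simp: bij_betw_def)
  have reind: "(\<Sum>v\<in>B. f v) = (\<Sum>i<n. f (b i))" for f :: "'k \<Rightarrow> 'c::comm_monoid_add"
    by (rule sum.reindex_bij_betw[OF b, symmetric])
  define M where "M = mat n n (\<lambda>(i,j). of_rat (rep (x * b j) (b i)) :: complex)"
  have M: "M \<in> carrier_mat n n" by (simp add: M_def)
  obtain es where es: "(\<Sum>i<n. M $$ (i,i)) = sum_list es" "\<And>a. a \<in> set es \<Longrightarrow> eigenvalue M a"
    using sum_diag_eq_sum_eigenvalues[OF M] by blast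
  have eig_int: "algebraic_int a" if "a \<in> set es" for a
  proof -
    have "eigenvalue (transpose_mat M) a"
      using es(2)[OF that] M by (simp add: eigenvalue_root_char_poly[of _ n])
    then obtain w where w: "w \<in> carrier_vec n" "w \<noteq> 0\<^sub>v n" "transpose_mat M *\<^sub>v w = a \<cdot>\<^sub>v w"
      unfolding eigenvalue_def eigenvector_def using M by auto
    define l where "l y = (\<Sum>i<n. of_rat (rep y (b i)) * vec_index w i)" for y
    have lb: "l (x * b j) = a * vec_index w j" if "j < n" for j
    proof -
      have "l (x * b j) = vec_index (transpose_mat M *\<^sub>v w) j"
        using that w(1) by (simp add: l_def M_def scalar_prod_def atLeast0LessThan)
      also have "\<dots> = a * vec_index w j" unfolding w(3) using that w(1) by simp
      finally show ?thesis .
    qed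
    have ladd: "l (y + z) = l y + l z" for y z
      by (simp add: l_def rep_add of_rat_add distrib_right sum.distrib)
    have lscale: "l (of_rat q * y) = of_rat q * l y" for q y
      unfolding l_def rep_scale of_rat_mult sum_distrib_left mult.assoc ..
    have lsum: "l (\<Sum>i<n. f i) = (\<Sum>i<n. l (f i))" for f
      unfolding l_def by (subst sum.swap) (simp add: rep_sum of_rat_sum sum_distrib_right)
    have "l (x * y) = a * l y" for y
    proof -
      have y: "y = (\<Sum>i<n. of_rat (rep y (b i)) * b i)"
        using sum_rep[of y] by (simp add: reind)
      have "l (x * y) = l (\<Sum>i<n. of_rat (rep y (b i)) * (x * b i))"
        by (subst y) (simp add: sum_distrib_left mult_ac)
      also have "\<dots> = (\<Sum>i<n. of_rat (rep y (b i)) * (a * vec_index w i))"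
        by (simp add: lsum lscale lb)
      also have "\<dots> = a * l y" by (simp add: l_def sum_distrib_left mult_ac)
      finally show ?thesis .
    qed
    moreover obtain i where i: "i < n" "vec_index w i \<noteq> 0"
      using w(1,2) by (metis carrier_vecD eq_vecI index_zero_vec(1,2))
    have "l (b i) = (\<Sum>j<n. (if j = i then vec_index w j else 0))"
      unfolding l_def
    proof (intro sum.cong refl)
      fix j assume "j \<in> {..<n}"
      then have "b j = b i \<longleftrightarrow> j = i"
        using b i(1) by (auto simp: bij_betw_def inj_on_def)
      then show "of_rat (rep (b i) (b j)) * vec_index w j = (if j = i then vec_index w j else 0)"
        using bB[OF i(1)] by (simp add: rep_basis)
    qed
    then have "l (b i) \<noteq> 0" using i by simp
    ultimately show ?thesis
      using algebraic_int_if_eigenvalue_of_functional[of l, OF ladd] x by blast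
  qed
  have "of_rat (field_trace x) = (\<Sum>i<n. M $$ (i,i))"
    by (simp add: field_trace_def reind M_def of_rat_sum)
  also have "\<dots> = sum_list es" by (rule es)
  also have "sum_list es \<in> \<O>\<^sub>K"
    using eig_int by (induction es) (auto simp: ring_of_integers_def[symmetric] intro!: integers.add,
        auto simp: ring_of_integers_def)
  finally have "algebraic_int (of_rat (field_trace x) :: complex)" by (simp add: ring_of_integers_def)
  then have "(of_rat (field_trace x) :: complex) \<in> \<int>"
    by (rule rational_algebraic_int_is_int) auto
  then obtain k where "(of_rat (field_trace x) :: complex) = of_rat (of_int k)"
    by (auto simp: Ints_def)
  then show ?thesis by (simp only: of_rat_eq_iff) auto
qed

text \<open>The elements \<open>u v\<close> form the trace-dual basis of \<open>B\<close>. The map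
  \<open>T\<close> reads off the traces against \<open>B\<close>; nondegeneracy makes it injective,
  hence bijective by finite dimension, and \<open>u v\<close> is the preimage of
  \<open>v\<close>.\<close>

lemma trace_coordinates:
  "\<exists>u. \<forall>x. x = (\<Sum>v\<in>B. of_rat (field_trace (x * v)) * u v)"
proof -
  interpret E: finite_dimensional_vector_space "\<lambda>(q::rat) (x::'k). of_rat q * x" B
    by unfold_locales (auto simp: finB indB spanB)
  define T where "T x = (\<Sum>v\<in>B. of_rat (field_trace (x * v)) * v)" for x
  have Tadd: "T (x + y) = T x + T y" for x y
    by (simp add: T_def distrib_right field_trace_add of_rat_add sum.distrib)
  have Tscale: "T (of_rat q * x) = of_rat q * T x" for q x
    unfolding T_def mult.assoc field_trace_scale of_rat_mult sum_distrib_left ..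
  have lin: "Vector_Spaces.linear (\<lambda>(q::rat) (x::'k). of_rat q * x) (\<lambda>(q::rat) (x::'k). of_rat q * x) T"
    by unfold_locales (auto simp: Tadd Tscale)
  have Tsum: "T (\<Sum>v\<in>B. f v) = (\<Sum>v\<in>B. T (f v))" for f
    using finB by (induction B rule: finite_induct) (auto simp: Tadd Tscale[of 0 0, simplified])
  have inj: "inj T"
    unfolding module_hom.inj_iff_eq_0[OF Vector_Spaces.linear.axioms(3)[OF lin]]
  proof (intro allI impI)
    fix x assume "T x = 0"
    then have *: "field_trace (x * v) = 0" if "v \<in> B" for v
      using indB[unfolded rat_vs.independent_explicit_module, rule_format, of B "\<lambda>v. field_trace (x * v)" v]
        finB that unfolding T_def by simp
    have tsum: "field_trace (\<Sum>v\<in>B. f v) = (\<Sum>v\<in>B. field_trace (f v))" for f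
      by (simp add: field_trace_def sum_distrib_right rep_sum) (rule sum.swap)
    have all: "field_trace (x * y) = 0" for y
    proof -
      have "x * y = (\<Sum>v\<in>B. of_rat (rep y v) * (x * v))"
        using sum_rep[of y] by (metis (no_types, lifting) mult.left_commute sum.cong sum_distrib_left)
      then show ?thesis using * by (simp add: tsum field_trace_scale)
    qed
    \<comment> \<open>The trace of \<open>x * y\<close> vanishes for every \<open>y\<close>, whereas
      for \<open>y = inverse x\<close> it would be the trace of 1.\<close>
    show "x = 0"
    proof (rule ccontr)
      assume "x \<noteq> 0"
      then show False using all[of "inverse x"] field_trace_one_nonzero by simp
    qed
  qed
  have surj: "surj T" using E.linear_inj_imp_surj[OF lin inj] .
  then obtain u where u: "\<And>v. T (u v) = v" unfolding surj_def by metis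
  have "x = (\<Sum>v\<in>B. of_rat (field_trace (x * v)) * u v)" for x
  proof -
    have "T (\<Sum>v\<in>B. of_rat (field_trace (x * v)) * u v) = T x"
      by (simp add: Tsum Tscale u) (simp add: T_def)
    then show ?thesis using inj by (simp add: inj_def)
  qed
  then show ?thesis by blast
qed

text \<open>The coordinates with respect to the dual basis are traces of products of algebraic
  integers, hence integers: \<open>\<O>\<^sub>K\<close> is contained in the lattice dual to
  \<open>B\<close>.\<close>

lemma ring_of_integers_coordinates:
  assumes "B \<subseteq> \<O>\<^sub>K"
  obtains u :: "'k \<Rightarrow> 'k" and t :: "'k \<Rightarrow> 'k \<Rightarrow> int" where "\<And>x. x \<in> \<O>\<^sub>K \<Longrightarrow> x = (\<Sum>v\<in>B. of_int (t x v) * u v)"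
proof -
  obtain u where u: "\<And>x. x = (\<Sum>v\<in>B. of_rat (field_trace (x * v)) * u v)"
    using trace_coordinates by blast
  have "\<exists>t. \<forall>v\<in>B. field_trace (x * v) = of_int (t v)" if "x \<in> \<O>\<^sub>K" for x
  proof -
    have "field_trace (x * v) \<in> \<int>" if "v \<in> B" for v
      using \<open>x \<in> \<O>\<^sub>K\<close> that assms integers.mult[of x v] by (intro field_trace_int) (auto simp: ring_of_integers_def)
    then show ?thesis unfolding Ints_def by (intro bchoice) auto
  qed
  then obtain t where t: "\<And>x v. x \<in> \<O>\<^sub>K \<Longrightarrow> v \<in> B \<Longrightarrow> field_trace (x * v) = of_int (t x v)"
    by metis
  have "x = (\<Sum>v\<in>B. of_int (t x v) * u v)" if "x \<in> \<O>\<^sub>K" for x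
    by (subst u) (simp add: t that)
  then show ?thesis using that by blast
qed

lemma multiple_in_int_span:
  "finite U \<Longrightarrow> \<exists>m::int. m \<noteq> 0 \<and> (\<forall>u\<in>U. of_int m * u \<in> int_mod.span B)"
proof -
  assume "finite U"
  then obtain D :: int where D: "D \<noteq> 0"
      "\<forall>p\<in>U \<times> B. \<exists>k. of_int D * rep (fst p) (snd p) = of_int k"
    using common_denominator[of "U \<times> B" "\<lambda>p. rep (fst p) (snd p)"] finB by blast
  have "of_int D * u \<in> int_mod.span B" if "u \<in> U" for u
  proof -
    have "\<forall>v\<in>B. \<exists>k. of_int D * rep u v = of_int k" using D(2) that by auto
    then obtain k where k: "\<And>v. v \<in> B \<Longrightarrow> of_int D * rep u v = of_int (k v)" by metis
    have "of_int D * u = (\<Sum>v\<in>B. of_rat (of_int D * rep u v) * v)"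
      using sum_rep[of u] by (simp add: of_rat_mult mult.assoc flip: sum_distrib_left)
    also have "\<dots> = (\<Sum>v\<in>B. of_int (k v) * v)" by (intro sum.cong refl) (simp add: k)
    also have "\<dots> \<in> int_mod.span B"
      by (intro int_mod.span_sum int_mod.span_scale int_mod.span_base)
    finally show ?thesis .
  qed
  then show ?thesis using D(1) by blast
qed

text \<open>\<open>m\<close> is a common denominator of the dual basis in terms of \<open>B\<close>,
  so it carries the whole dual lattice, which contains \<open>\<O>\<^sub>K\<close>, into the lattice
  of \<open>B\<close>.\<close>

lemma ring_of_integers_multiple_in_int_span:
  assumes "B \<subseteq> \<O>\<^sub>K"
  shows "\<exists>m::int. m \<noteq> 0 \<and> (\<forall>x\<in>\<O>\<^sub>K. of_int m * x \<in> int_mod.span B)"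
proof -
  obtain u :: "'k \<Rightarrow> 'k" and t where ut: "\<And>x. x \<in> \<O>\<^sub>K \<Longrightarrow> x = (\<Sum>v\<in>B. of_int (t x v) * u v)"
    using ring_of_integers_coordinates[OF assms] by blast
  obtain m :: int where m: "m \<noteq> 0" "\<forall>v\<in>B. of_int m * u v \<in> int_mod.span B"
    using multiple_in_int_span[of "u ` B"] finB by blast
  have "of_int m * x \<in> int_mod.span B" if "x \<in> \<O>\<^sub>K" for x
  proof -
    have "of_int m * x = of_int m * (\<Sum>v\<in>B. of_int (t x v) * u v)"
      by (rule arg_cong[OF ut[OF that]])
    also have "\<dots> = (\<Sum>v\<in>B. of_int (t x v) * (of_int m * u v))"
      by (simp add: sum_distrib_left mult.left_commute)
    also have "\<dots> \<in> int_mod.span B"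
      using m(2) by (intro int_mod.span_sum int_mod.span_scale[of "of_int m * _"]) auto
    finally show ?thesis .
  qed
  then show ?thesis using m(1) by blast
qed

text \<open>\<open>g\<close> expresses the finiteness of \<open>\<O>\<^sub>K/N\<O>\<^sub>K\<close>
  without a quotient: it has finitely many values, and elements with equal values are congruent
  modulo \<open>N\<close>. It may be finer than that congruence.\<close>

lemma finite_residues_ring_of_integers:
  assumes BO: "B \<subseteq> \<O>\<^sub>K" and N: "(N::int) \<noteq> 0"
  obtains g :: "'k \<Rightarrow> 'k \<Rightarrow> int" where "finite (g ` \<O>\<^sub>K)"
    "\<And>x y. x \<in> \<O>\<^sub>K \<Longrightarrow> y \<in> \<O>\<^sub>K \<Longrightarrow> g x = g y \<Longrightarrow> \<exists>z\<in>\<O>\<^sub>K. x - y = of_int N * z"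
proof -
  obtain u :: "'k \<Rightarrow> 'k" and t where ut: "\<And>x. x \<in> \<O>\<^sub>K \<Longrightarrow> x = (\<Sum>v\<in>B. of_int (t x v) * u v)"
    using ring_of_integers_coordinates[OF BO] by blast
  obtain m :: int where m: "m \<noteq> 0" "\<forall>v\<in>B. of_int m * u v \<in> int_mod.span B"
    using multiple_in_int_span[of "u ` B"] finB by blast
  \<comment> \<open>The modulus carries the factor \<open>m\<close> because \<open>u v\<close> need
    not be an algebraic integer, while \<open>m * u v\<close> is one. Coordinates congruent modulo
    \<open>m * N\<close> thus leave a difference of \<open>N\<close> times an element of
    \<open>\<O>\<^sub>K\<close>.\<close>
  define g where "g x = restrict (\<lambda>v. t x v mod \<bar>m * N\<bar>) B" for x
  have pos: "\<bar>m * N\<bar> > 0" using m N by simp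
  have "g ` \<O>\<^sub>K \<subseteq> B \<rightarrow>\<^sub>E {0..<\<bar>m * N\<bar>}"
    using pos by (auto simp: g_def)
  then have "finite (g ` \<O>\<^sub>K)"
    by (rule finite_subset) (auto intro: finite_PiE finB)
  moreover have "\<exists>z\<in>\<O>\<^sub>K. x - y = of_int N * z"
    if "x \<in> \<O>\<^sub>K" "y \<in> \<O>\<^sub>K" "g x = g y" for x y
  proof -
    have "\<exists>k. t x v - t y v = m * N * k" if "v \<in> B" for v
    proof -
      have "t x v mod \<bar>m * N\<bar> = t y v mod \<bar>m * N\<bar>"
        using fun_cong[OF \<open>g x = g y\<close>, of v] that by (simp add: g_def)
      then have "m * N dvd t x v - t y v" by (simp add: mod_eq_dvd_iff)
      then show ?thesis by (auto simp: dvd_def)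
    qed
    then obtain k where k: "\<And>v. v \<in> B \<Longrightarrow> t x v - t y v = m * N * k v" by metis
    have "x - y = (\<Sum>v\<in>B. of_int (t x v) * u v) - (\<Sum>v\<in>B. of_int (t y v) * u v)"
      by (rule arg_cong2[OF ut[OF that(1)] ut[OF that(2)]])
    also have "\<dots> = (\<Sum>v\<in>B. of_int (t x v - t y v) * u v)"
      by (simp add: sum_subtractf left_diff_distrib)
    also have "\<dots> = (\<Sum>v\<in>B. of_int N * (of_int (k v) * (of_int m * u v)))"
    proof (intro sum.cong refl)
      fix v assume "v \<in> B"
      then show "of_int (t x v - t y v) * u v = of_int N * (of_int (k v) * (of_int m * u v))"
        unfolding k[OF \<open>v \<in> B\<close>] of_int_mult by (metis mult.assoc mult.commute)
    qed
    finally have "x - y = of_int N * (\<Sum>v\<in>B. of_int (k v) * (of_int m * u v))"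
      by (simp add: sum_distrib_left)
    moreover have "(\<Sum>v\<in>B. of_int (k v) * (of_int m * u v)) \<in> \<O>\<^sub>K"
    proof (rule integers.sum)
      fix v assume "v \<in> B"
      then have "of_int m * u v \<in> \<O>\<^sub>K" using m(2) integers.int_span_subset[OF BO] by blast
      then show "of_int (k v) * (of_int m * u v) \<in> \<O>\<^sub>K" by (rule integers.mult[OF integers.of_int])
    qed
    ultimately show ?thesis by blast
  qed
  ultimately show ?thesis using that by blast
qed

end

section \<open>Ideals and primes of subrings\<close>

definition ideal_in :: "'k::field_char_0 set \<Rightarrow> 'k set \<Rightarrow> bool" where
  "ideal_in R I \<longleftrightarrow> I \<subseteq> R \<and> 0 \<in> I \<and> (\<forall>x\<in>I. \<forall>y\<in>I. x + y \<in> I) \<and> (\<forall>r\<in>R. \<forall>x\<in>I. r * x \<in> I)"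

definition prime_in :: "'k::field_char_0 set \<Rightarrow> 'k set \<Rightarrow> bool" where
  "prime_in R P \<longleftrightarrow> ideal_in R P \<and> 1 \<notin> P \<and> (\<forall>a\<in>R. \<forall>b\<in>R. a * b \<in> P \<longrightarrow> a \<in> P \<or> b \<in> P)"

lemma ideal_inD:
  assumes "ideal_in R I"
  shows "I \<subseteq> R" "0 \<in> I" "x \<in> I \<Longrightarrow> y \<in> I \<Longrightarrow> x + y \<in> I" "r \<in> R \<Longrightarrow> x \<in> I \<Longrightarrow> r * x \<in> I"
    "r \<in> R \<Longrightarrow> x \<in> I \<Longrightarrow> x * r \<in> I"
  using assms by (auto simp: ideal_in_def mult.commute)

lemma prime_inD:
  assumes "prime_in R P"
  shows "ideal_in R P" "1 \<notin> P" "a \<in> R \<Longrightarrow> b \<in> R \<Longrightarrow> a * b \<in> P \<Longrightarrow> a \<in> P \<or> b \<in> P"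
  using assms by (auto simp: prime_in_def)

lemma ring_on_simps [simp]:
  "carrier (ring_on R) = R" "x \<otimes>\<^bsub>ring_on R\<^esub> y = x * y" "x \<oplus>\<^bsub>ring_on R\<^esub> y = x + y"
  "\<one>\<^bsub>ring_on R\<^esub> = 1" "\<zero>\<^bsub>ring_on R\<^esub> = 0"
  by (simp_all add: ring_of_type_algebra_def)

lemma ring_of_type_algebra_simps [simp]:
  "x \<otimes>\<^bsub>ring_of_type_algebra\<^esub> y = x * y" "x \<oplus>\<^bsub>ring_of_type_algebra\<^esub> y = x + y"
  "\<one>\<^bsub>ring_of_type_algebra\<^esub> = 1" "\<zero>\<^bsub>ring_of_type_algebra\<^esub> = 0"
  by (simp_all add: ring_of_type_algebra_def)

context field_subring
begin

lemma cring_ring_on: "cring (ring_on R)"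
proof (rule cringI)
  show "abelian_group (ring_on R)"
  proof (rule abelian_groupI)
    fix x assume "x \<in> carrier (ring_on R)"
    then show "\<exists>y\<in>carrier (ring_on R). y \<oplus>\<^bsub>ring_on R\<^esub> x = \<zero>\<^bsub>ring_on R\<^esub>"
      using neg[of x] by (intro bexI[of _ "- x"]) auto
  qed (auto simp: algebra_simps)
  show "comm_monoid (ring_on R)"
    by (rule comm_monoidI) (auto simp: mult_ac)
qed (auto simp: algebra_simps)

lemma domain_ring_on: "domain (ring_on R)"
  using cring_ring_on by (intro domain.intro) (auto simp: domain_axioms_def)

lemma ideal_in_diff: "ideal_in R I \<Longrightarrow> x \<in> I \<Longrightarrow> y \<in> I \<Longrightarrow> x - y \<in> I"
  using ideal_inD(3)[of R I x "(-1) * y"] ideal_inD(4)[of R I "-1" y] neg[OF one] by simp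

lemma ideal_in_minus: "ideal_in R I \<Longrightarrow> x \<in> I \<Longrightarrow> - x \<in> I"
  using ideal_inD(4)[of R I "-1" x] neg[OF one] by simp

lemma subgroup_ring_on:
  assumes "I \<subseteq> R" "0 \<in> I" "\<And>x y. x \<in> I \<Longrightarrow> y \<in> I \<Longrightarrow> x + y \<in> I" "\<And>x. x \<in> I \<Longrightarrow> - x \<in> I"
  shows "subgroup I (add_monoid (ring_on R))"
proof -
  interpret cring "ring_on R" by (rule cring_ring_on)
  have "\<ominus>\<^bsub>ring_on R\<^esub> x = - x" if "x \<in> R" for x
    using that neg[OF that] by (intro minus_equality) auto
  then show ?thesis
    using assms by (intro add.subgroupI) (auto simp: a_inv_def)
qed

lemma ideal_ring_on_iff: "ideal I (ring_on R) \<longleftrightarrow> ideal_in R I"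
proof
  assume "ideal I (ring_on R)"
  then interpret ideal I "ring_on R" .
  show "ideal_in R I"
    using a_subset additive_subgroup.zero_closed[OF is_additive_subgroup]
      additive_subgroup.a_closed[OF is_additive_subgroup] I_l_closed by (auto simp: ideal_in_def)
next
  assume I: "ideal_in R I"
  interpret cring "ring_on R" by (rule cring_ring_on)
  show "ideal I (ring_on R)"
  proof (rule idealI)
    show "subgroup I (add_monoid (ring_on R))"
      using ideal_inD[OF I] ideal_in_minus[OF I] by (intro subgroup_ring_on)
  qed (use ideal_inD[OF I] in \<open>auto intro: ring_axioms\<close>)
qed

lemma primeideal_ring_on_iff: "primeideal P (ring_on R) \<longleftrightarrow> prime_in R P"
proof
  assume "primeideal P (ring_on R)"
  then interpret primeideal P "ring_on R" .
  have I: "ideal_in R P" using is_ideal ideal_ring_on_iff by simp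
  have "1 \<notin> P"
    using I_notcarr one_imp_carrier by auto
  then show "prime_in R P" using I I_prime by (auto simp: prime_in_def)
next
  assume P: "prime_in R P"
  show "primeideal P (ring_on R)"
    using prime_inD[OF P] cring_ring_on ideal_ring_on_iff one
    by (intro primeidealI) auto
qed

lemma nonzero_primes_iff: "P \<in> nonzero_primes R \<longleftrightarrow> prime_in R P \<and> P \<noteq> {0}"
  by (simp add: nonzero_primes_def primeideal_ring_on_iff)

lemma prime_in_power: "prime_in R P \<Longrightarrow> x \<in> R \<Longrightarrow> x ^ n \<in> P \<Longrightarrow> x \<in> P"
  by (induction n) (auto dest: prime_inD)

lemma prime_in_prod:
  "finite A \<Longrightarrow> prime_in R P \<Longrightarrow> (\<And>i. i \<in> A \<Longrightarrow> f i \<in> R) \<Longrightarrow> prod f A \<in> P \<Longrightarrow> \<exists>i\<in>A. f i \<in> P"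
proof (induction A rule: finite_induct)
  case empty
  then show ?case by (auto dest: prime_inD)
next
  case (insert a A)
  have "prod f A \<in> R" using insert.prems by (intro prod) auto
  then show ?case using insert by (auto dest: prime_inD(3))
qed

end

section \<open>Localizations\<close>

locale subring_prime = field_subring R for R :: "'k::field_char_0 set" +
  fixes P assumes prime: "prime_in R P"
begin

abbreviation "V \<equiv> localization R P"

definition local_maximal :: "'k set" where
  "local_maximal = {a / s | a s. a \<in> P \<and> s \<in> R - P}"

lemmas prime_facts = prime_inD[OF prime] ideal_inD[OF prime_inD(1)[OF prime]]

lemma nonzero_denominator: "s \<in> R - P \<Longrightarrow> s \<noteq> 0"
  using prime_facts by auto

lemma denominator_mult: "s \<in> R - P \<Longrightarrow> t \<in> R - P \<Longrightarrow> s * t \<in> R - P"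
  using prime_facts by auto

lemma subset_localization: "R \<subseteq> V"
proof
  fix x assume "x \<in> R"
  then show "x \<in> V" unfolding localization_def using prime_facts(2)
    by (intro CollectI exI[of _ x] exI[of _ 1]) auto
qed

lemma in_localization_iff: "x \<in> V \<longleftrightarrow> (\<exists>s\<in>R - P. s * x \<in> R)"
proof
  assume "x \<in> V"
  then obtain a s where "x = a / s" "a \<in> R" "s \<in> R - P" by (auto simp: localization_def)
  then show "\<exists>s\<in>R - P. s * x \<in> R" using nonzero_denominator[of s] by (intro bexI[of _ s]) auto
next
  assume "\<exists>s\<in>R - P. s * x \<in> R"
  then obtain s where s: "s \<in> R - P" "s * x \<in> R" by blast
  then have "x = (s * x) / s" using nonzero_denominator[of s] by auto
  then show "x \<in> V" using s unfolding localization_def by blast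
qed

lemma in_local_maximal_iff: "x \<in> local_maximal \<longleftrightarrow> (\<exists>s\<in>R - P. s * x \<in> P)"
proof
  assume "x \<in> local_maximal"
  then obtain a s where "x = a / s" "a \<in> P" "s \<in> R - P" by (auto simp: local_maximal_def)
  then show "\<exists>s\<in>R - P. s * x \<in> P" using nonzero_denominator[of s] by (intro bexI[of _ s]) auto
next
  assume "\<exists>s\<in>R - P. s * x \<in> P"
  then obtain s where s: "s \<in> R - P" "s * x \<in> P" by blast
  then have "x = (s * x) / s" using nonzero_denominator[of s] by auto
  then show "x \<in> local_maximal" using s unfolding local_maximal_def by blast
qed

lemma field_subring_localization: "field_subring V"
proof
  show "1 \<in> V" using subset_localization by auto
next
  fix x y assume "x \<in> V" "y \<in> V"
  then obtain s t where st: "s \<in> R - P" "s * x \<in> R" "t \<in> R - P" "t * y \<in> R"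
    unfolding in_localization_iff by blast
  have "(s * t) * (x - y) = t * (s * x) - s * (t * y)" "(s * t) * (x * y) = (s * x) * (t * y)"
    by (simp_all add: algebra_simps)
  moreover have "t * (s * x) - s * (t * y) \<in> R" "(s * x) * (t * y) \<in> R" using st by auto
  ultimately show "x - y \<in> V" "x * y \<in> V"
    unfolding in_localization_iff using denominator_mult[OF st(1,3)] by metis+
qed

sublocale loc: field_subring V by (rule field_subring_localization)

lemma inverse_denominator: "s \<in> R - P \<Longrightarrow> 1 / s \<in> V"
  unfolding localization_def by blast

lemma local_maximal_subset: "local_maximal \<subseteq> V"
  using prime_facts(4) unfolding local_maximal_def localization_def by blast

lemma local_maximal_iff: "x \<in> R \<Longrightarrow> x \<in> local_maximal \<longleftrightarrow> x \<in> P"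
proof
  assume "x \<in> R" "x \<in> local_maximal"
  then show "x \<in> P" unfolding in_local_maximal_iff using prime_facts(3) by blast
next
  assume "x \<in> R" "x \<in> P"
  then show "x \<in> local_maximal" unfolding in_local_maximal_iff
    using prime_facts(2) by (intro bexI[of _ 1]) auto
qed

lemma ideal_local_maximal: "ideal_in V local_maximal"
  unfolding ideal_in_def
proof (intro conjI ballI local_maximal_subset)
  show "0 \<in> local_maximal" using local_maximal_iff[of 0] prime_facts by auto
next
  fix x y assume "x \<in> local_maximal" "y \<in> local_maximal"
  then obtain s t where st: "s \<in> R - P" "s * x \<in> P" "t \<in> R - P" "t * y \<in> P"
    unfolding in_local_maximal_iff by blast
  have "(s * t) * (x + y) = t * (s * x) + s * (t * y)" by (simp add: algebra_simps)
  moreover have "t * (s * x) + s * (t * y) \<in> P" using st prime_facts by auto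
  ultimately show "x + y \<in> local_maximal"
    unfolding in_local_maximal_iff using denominator_mult[OF st(1,3)] by metis
next
  fix r x assume "r \<in> V" "x \<in> local_maximal"
  then obtain s t where st: "s \<in> R - P" "s * r \<in> R" "t \<in> R - P" "t * x \<in> P"
    unfolding in_local_maximal_iff in_localization_iff by blast
  have "(s * t) * (r * x) = (s * r) * (t * x)" by (simp add: algebra_simps)
  moreover have "(s * r) * (t * x) \<in> P" using st prime_facts by auto
  ultimately show "r * x \<in> local_maximal"
    unfolding in_local_maximal_iff using denominator_mult[OF st(1,3)] by metis
qed

lemma one_notin_local_maximal: "1 \<notin> local_maximal"
  using local_maximal_iff[of 1] prime_facts by auto

lemma unit_outside_local_maximal:
  assumes "x \<in> V" "x \<notin> local_maximal"
  shows "x \<noteq> 0" "1 / x \<in> V"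
proof -
  obtain s where s: "s \<in> R - P" "s * x \<in> R" using assms(1) in_localization_iff by blast
  with assms(2) have "s * x \<in> R - P" unfolding in_local_maximal_iff by blast
  then have "1 / (s * x) \<in> V" "s * x \<noteq> 0" using inverse_denominator nonzero_denominator by blast+
  then have "s * (1 / (s * x)) \<in> V" using s subset_localization by blast
  then show "x \<noteq> 0" "1 / x \<in> V" using \<open>s * x \<noteq> 0\<close> by auto
qed

lemma prime_local_maximal: "prime_in V local_maximal"
  unfolding prime_in_def
proof (intro conjI ideal_local_maximal one_notin_local_maximal ballI impI)
  fix a b assume ab: "a \<in> V" "b \<in> V" "a * b \<in> local_maximal"
  show "a \<in> local_maximal \<or> b \<in> local_maximal"
  proof (rule ccontr)
    assume "\<not> ?thesis"
    then have "a \<noteq> 0" "b \<noteq> 0" "1 / a \<in> V" "1 / b \<in> V"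
      using unit_outside_local_maximal ab by auto
    then have "(1 / a * (1 / b)) * (a * b) \<in> local_maximal"
      using ab(3) ideal_inD(4)[OF ideal_local_maximal] by blast
    then show False using \<open>a \<noteq> 0\<close> \<open>b \<noteq> 0\<close> one_notin_local_maximal by simp
  qed
qed

lemma ideal_contraction: "ideal_in V I \<Longrightarrow> ideal_in R (I \<inter> R)"
  using subset_localization unfolding ideal_in_def by auto

lemma prime_contraction: "prime_in V Q \<Longrightarrow> prime_in R (Q \<inter> R)"
  using subset_localization ideal_contraction unfolding prime_in_def by blast

lemma proper_ideal_subset_local_maximal:
  assumes "ideal_in V I" "1 \<notin> I"
  shows "I \<subseteq> local_maximal"
proof (rule ccontr)
  assume "\<not> I \<subseteq> local_maximal"
  then obtain x where "x \<in> I" "x \<notin> local_maximal" by blast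
  moreover from this have "x \<in> V" using ideal_inD[OF assms(1)] by blast
  ultimately have "1 / x * x \<in> I" "x \<noteq> 0"
    using unit_outside_local_maximal[of x] ideal_inD(4)[OF assms(1)] by blast+
  then show False using assms(2) by simp
qed

end

section \<open>Valuation rings\<close>

text \<open>Multiplying the monic equation of degree \<open>d\<close> by
  \<open>(1 / x) ^ (d - 1)\<close> expresses \<open>x\<close> as an integer polynomial in
  \<open>1 / x\<close>.\<close>

lemma algebraic_int_in_ring_if_inverse:
  fixes x :: "'k::field_char_0"
  assumes V: "field_subring V" and x: "algebraic_int x" and inv: "1 / x \<in> V"
  shows "x \<in> V"
proof (cases "x = 0")
  case True
  then show ?thesis using V field_subring.zero by blast
next
  case False
  interpret field_subring V by fact
  obtain p where p: "poly (map_poly of_int p) x = 0" "lead_coeff p = 1"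
    using x unfolding algebraic_int_altdef_ipoly by blast
  define d where "d = Polynomial.degree p"
  have dpos: "d > 0"
  proof (rule ccontr)
    assume "\<not> d > 0"
    then obtain c where "p = [:c:]" by (auto simp: d_def elim: degree_eq_zeroE)
    then show False using p by auto
  qed
  have "0 = (\<Sum>i\<le>d. of_int (Polynomial.coeff p i) * x ^ i)"
    using p(1) by (simp add: poly_altdef degree_map_poly coeff_map_poly d_def)
  also have "{..d} = insert d {..<d}" by auto
  also have "(\<Sum>i\<in>\<dots>. of_int (Polynomial.coeff p i) * x ^ i)
      = x ^ d + (\<Sum>i<d. of_int (Polynomial.coeff p i) * x ^ i)"
    using p(2) by (simp add: d_def)
  finally have "x ^ d = - (\<Sum>i<d. of_int (Polynomial.coeff p i) * x ^ i)"
    by (simp add: eq_neg_iff_add_eq_0)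
  then have "x ^ d * (1 / x) ^ (d - 1) = - (\<Sum>i<d. of_int (Polynomial.coeff p i) * (x ^ i * (1 / x) ^ (d - 1)))"
    by (simp add: sum_distrib_right mult.assoc)
  also have "x ^ d * (1 / x) ^ (d - 1) = x"
    using dpos False by (cases d) (auto simp: power_divide)
  also have "(\<Sum>i<d. of_int (Polynomial.coeff p i) * (x ^ i * (1 / x) ^ (d - 1)))
     = (\<Sum>i<d. of_int (Polynomial.coeff p i) * (1 / x) ^ (d - 1 - i))"
    using False by (intro sum.cong refl) (auto simp: power_divide power_diff)
  finally have "x = - (\<Sum>i<d. of_int (Polynomial.coeff p i) * (1 / x) ^ (d - 1 - i))" .
  also have "\<dots> \<in> V"
    using inv by (intro neg sum mult of_int power)
  finally show ?thesis .
qed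

text \<open>After multiplication by \<open>c ^ n\<close> the relation is monic in
  \<open>c * x\<close>, with lower coefficients \<open>f k * c ^ (n - k)\<close>.\<close>

lemma integral_leading_coefficient_times_root:
  fixes x :: "'k::field_char_0"
  assumes c: "c \<in> \<O>\<^sub>K" and f: "\<And>k. f k \<in> \<O>\<^sub>K"
    and root: "c * x ^ Suc n + (\<Sum>k<Suc n. f k * x ^ k) = 0"
  shows "c * x \<in> \<O>\<^sub>K"
proof -
  define g where "g k = (if k = Suc n then 1 else f k * c ^ (n - k))" for k
  define p where "p = (\<Sum>k\<le>Suc n. Polynomial.monom (g k) k)"
  have co: "Polynomial.coeff p i = (if i \<le> Suc n then g i else 0)" for i
    by (simp add: p_def Polynomial.coeff_sum)
  have deg: "Polynomial.degree p = Suc n"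
  proof (rule antisym)
    show "Polynomial.degree p \<le> Suc n" by (rule degree_le) (simp add: co)
    show "Suc n \<le> Polynomial.degree p" by (rule le_degree) (simp add: co g_def)
  qed
  have "poly p (c * x) = (\<Sum>k\<le>Suc n. g k * (c * x) ^ k)"
    by (simp add: p_def poly_sum poly_monom)
  also have "{..Suc n} = insert (Suc n) {..<Suc n}" by auto
  also have "(\<Sum>k\<in>\<dots>. g k * (c * x) ^ k) = (c * x) ^ Suc n + (\<Sum>k<Suc n. g k * (c * x) ^ k)"
    by (simp add: g_def)
  also have "(\<Sum>k<Suc n. g k * (c * x) ^ k) = (\<Sum>k<Suc n. c ^ n * (f k * x ^ k))"
  proof (intro sum.cong refl)
    fix k assume "k \<in> {..<Suc n}"
    then have "c ^ n = c ^ (n - k) * c ^ k" by (simp flip: power_add)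
    then show "g k * (c * x) ^ k = c ^ n * (f k * x ^ k)"
      using \<open>k \<in> _\<close> by (simp add: g_def power_mult_distrib)
  qed
  also have "(c * x) ^ Suc n + (\<Sum>k<Suc n. c ^ n * (f k * x ^ k))
      = c ^ n * (c * x ^ Suc n + (\<Sum>k<Suc n. f k * x ^ k))"
    unfolding sum_distrib_left[symmetric] by (simp add: algebra_simps power_mult_distrib)
  also have "\<dots> = 0" using root by simp
  finally have "poly p (c * x) = 0" .
  moreover have "Polynomial.coeff p i \<in> \<O>\<^sub>K" for i
    using c f by (auto simp: co g_def intro!: integers.mult integers.power)
  ultimately show ?thesis
    using ring_of_integers_integrally_closed[of p "c * x"] by (simp add: deg co g_def)
qed

text \<open>
  Seidenberg's lemma: \<open>b\<close> and \<open>b'\<close> are consecutive Horner partial evaluations of \<open>f\<close> at \<open>x\<close>. If the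
  coefficient is a unit in a local ring containing \<open>\<O>\<^sub>K\<close>, then \<open>b\<close> or \<open>x * b'\<close> is a unit, which puts
  \<open>x\<close> or \<open>1 / x\<close> into that ring.
\<close>

lemma horner_integral:
  fixes x :: "'k::field_char_0"
  assumes root: "poly (map_poly of_int f) x = 0"
  shows "\<exists>b\<in>\<O>\<^sub>K. \<exists>b'\<in>\<O>\<^sub>K. x * b \<in> \<O>\<^sub>K \<and> x * b' \<in> \<O>\<^sub>K \<and> of_int (Polynomial.coeff f j) = b - x * b'"
proof -
  define n where "n = Polynomial.degree f"
  define c :: "nat \<Rightarrow> 'k" where "c k = of_int (Polynomial.coeff f k)" for k
  define b where "b i = (\<Sum>k=i..n. c k * x ^ (k - i))" for i
  have cO: "c k \<in> \<O>\<^sub>K" for k by (simp add: c_def integers.of_int)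
  have step: "b i = c i + x * b (Suc i)" if "i \<le> n" for i
  proof -
    have "b i = c i + (\<Sum>k=Suc i..n. c k * x ^ (k - i))"
      using that by (simp add: b_def sum.atLeast_Suc_atMost)
    also have "(\<Sum>k=Suc i..n. c k * x ^ (k - i)) = (\<Sum>k=Suc i..n. x * (c k * x ^ (k - Suc i)))"
    proof (intro sum.cong refl)
      fix k assume "k \<in> {Suc i..n}"
      then have "k - i = Suc (k - Suc i)" by auto
      then show "c k * x ^ (k - i) = x * (c k * x ^ (k - Suc i))" by simp
    qed
    finally show ?thesis by (simp add: b_def sum_distrib_left)
  qed
  have b0: "b 0 = 0"
    using root by (simp add: b_def poly_altdef degree_map_poly coeff_map_poly n_def c_def atLeast0AtMost)
  \<comment> \<open>This is \<open>f(x) = 0\<close> with the upper terms collected into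
    \<open>b i\<close>. It makes \<open>b i\<close> the leading coefficient of a relation of degree
    \<open>i\<close> for \<open>x\<close>, so \<open>x * b i\<close> is integral as soon as
    \<open>b i\<close> is.\<close>
  have low: "b i * x ^ i + (\<Sum>k<i. c k * x ^ k) = 0" if "i \<le> Suc n" for i
    using that
  proof (induction i)
    case 0
    then show ?case by (simp add: b0)
  next
    case (Suc i)
    then show ?case using step[of i] by (simp add: algebra_simps)
  qed
  have xb: "x * b i \<in> \<O>\<^sub>K" if "b i \<in> \<O>\<^sub>K" "i \<le> Suc n" for i
  proof (cases i)
    case 0
    then show ?thesis by (simp add: b0)
  next
    case (Suc m)
    then show ?thesis
      using integral_leading_coefficient_times_root[of "b i" c x m] that cO low[of i]
      by (simp add: mult.commute)
  qed
  \<comment> \<open>Downward induction from the empty sum \<open>b (Suc n) = 0\<close>: integrality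
    of \<open>b (Suc i)\<close> gives that of \<open>x * b (Suc i)\<close>, hence that of
    \<open>b i\<close>.\<close>
  have bO: "b (Suc n - i) \<in> \<O>\<^sub>K" for i
  proof (induction i)
    case 0
    then show ?case by (simp add: b_def)
  next
    case (Suc i)
    show ?case
    proof (cases "i \<le> n")
      case True
      then have "b (Suc n - Suc i) = c (n - i) + x * b (Suc n - i)"
        using step[of "n - i"] by (simp add: Suc_diff_le)
      then show ?thesis using xb[OF Suc] cO integers.add by auto
    next
      case False
      then show ?thesis using Suc by simp
    qed
  qed
  have bO': "b i \<in> \<O>\<^sub>K" for i
  proof (cases "i \<le> Suc n")
    case True
    then show ?thesis using bO[of "Suc n - i"] by simp
  qed (simp add: b_def)
  show ?thesis
  proof (cases "j \<le> n")
    case True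
    then have "c j = b j - x * b (Suc j)" using step by simp
    then show ?thesis using bO' xb[of j] xb[of "Suc j"] True unfolding c_def
      by (intro bexI[of _ "b j"] bexI[of _ "b (Suc j)"]) auto
  next
    case False
    then show ?thesis
      by (intro bexI[of _ 0]) (auto simp: n_def coeff_eq_0)
  qed
qed

section \<open>Orders\<close>

text \<open>These are the consequences of full rank on which the rest is built. They pass at once to
  every ring between \<open>R\<close> and \<open>\<O>\<^sub>K\<close>, so components and
  intersections need no basis of their own. The condition \<open>residues\<close> concerns
  \<open>\<O>\<^sub>K\<close> alone and carries what is used of the number field.\<close>

locale integer_order = field_subring R for R :: "'k::field_char_0 set" +
  assumes subset_integers: "R \<subseteq> \<O>\<^sub>K"
    and multiple: "\<exists>m::int. m \<noteq> 0 \<and> (\<forall>x\<in>\<O>\<^sub>K. of_int m * x \<in> R)"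
    and residues: "\<And>N::int. N \<noteq> 0 \<Longrightarrow> \<exists>g :: 'k \<Rightarrow> 'k \<Rightarrow> int. finite (g ` \<O>\<^sub>K) \<and>
      (\<forall>x\<in>\<O>\<^sub>K. \<forall>y\<in>\<O>\<^sub>K. g x = g y \<longrightarrow> (\<exists>z\<in>\<O>\<^sub>K. x - y = of_int N * z))"
begin

text \<open>The conductor, with the integral closure already identified with \<open>\<O>\<^sub>K\<close>.\<close>

definition cond :: "'k set" where
  "cond = {x. \<forall>y\<in>\<O>\<^sub>K. x * y \<in> R}"

lemma condD: "x \<in> cond \<Longrightarrow> y \<in> \<O>\<^sub>K \<Longrightarrow> x * y \<in> R"
  by (simp add: cond_def)

lemma cond_subset: "cond \<subseteq> R"
  using condD[OF _ integers.one] by fastforce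

lemma cond_mult_integer: "x \<in> cond \<Longrightarrow> y \<in> \<O>\<^sub>K \<Longrightarrow> x * y \<in> cond"
  by (auto simp: cond_def mult.assoc)

lemma ideal_integers_cond: "ideal_in \<O>\<^sub>K cond"
  unfolding ideal_in_def
proof (intro conjI ballI)
  show "cond \<subseteq> \<O>\<^sub>K" using cond_subset subset_integers by blast
  show "0 \<in> cond" by (simp add: cond_def)
  show "x + y \<in> cond" if "x \<in> cond" "y \<in> cond" for x y
    using that by (auto simp: cond_def distrib_right)
  show "r * x \<in> cond" if "r \<in> \<O>\<^sub>K" "x \<in> cond" for r x
    using cond_mult_integer[OF that(2,1)] by (simp add: mult.commute)
qed

lemma ideal_cond: "ideal_in R cond"
  using ideal_integers_cond cond_subset subset_integers unfolding ideal_in_def by blast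

lemma conductor_eq: "conductor R = cond"
proof -
  have "integral_closure R = \<O>\<^sub>K"
  proof
    show "integral_closure R \<subseteq> \<O>\<^sub>K"
      using subset_integers ring_of_integers_integrally_closed
      unfolding integral_closure_def by blast
    have "\<int> \<subseteq> R" by (auto simp: Ints_def)
    then show "\<O>\<^sub>K \<subseteq> integral_closure R"
      unfolding integral_closure_def ring_of_integers_def algebraic_int.simps by blast
  qed
  then show ?thesis by (simp add: conductor_def cond_def)
qed

lemma int_in_cond: "\<exists>m::int. m \<noteq> 0 \<and> of_int m \<in> cond"
  using multiple by (auto simp: cond_def)

text \<open>Such a set is a union of fibres of the residue map \<open>g\<close>, hence determined by
  its image in a finite set.\<close>

lemma finite_subgroups:
  assumes "(N::int) \<noteq> 0"
  shows "finite {G :: 'k set. G \<subseteq> \<O>\<^sub>K \<and> (\<forall>x\<in>G. \<forall>y\<in>G. x + y \<in> G) \<and> (\<forall>z\<in>\<O>\<^sub>K. of_int N * z \<in> G)}"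
    (is "finite ?S")
proof -
  obtain g :: "'k \<Rightarrow> 'k \<Rightarrow> int" where g: "finite (g ` \<O>\<^sub>K)"
    "\<And>x y. x \<in> \<O>\<^sub>K \<Longrightarrow> y \<in> \<O>\<^sub>K \<Longrightarrow> g x = g y \<Longrightarrow> \<exists>z\<in>\<O>\<^sub>K. x - y = of_int N * z"
    using residues[OF assms] by blast
  have *: "G = {x \<in> \<O>\<^sub>K. g x \<in> g ` G}" if G: "G \<in> ?S" for G :: "'k set"
  proof -
    have "x \<in> G" if x: "x \<in> \<O>\<^sub>K" "g x \<in> g ` G" for x
    proof -
      obtain y where y: "y \<in> G" "g x = g y" using x(2) by blast
      then obtain z where "z \<in> \<O>\<^sub>K" "x - y = of_int N * z"
        using g(2)[OF x(1), of y] G by blast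
      then have "y + of_int N * z \<in> G" "x = y + of_int N * z" using y(1) G by (auto simp: algebra_simps)
      then show ?thesis by simp
    qed
    then show ?thesis using G by blast
  qed
  have "inj_on (image g) ?S"
  proof (rule inj_onI)
    fix G H assume GH: "G \<in> ?S" "H \<in> ?S" "g ` G = g ` H"
    have "G = {x \<in> \<O>\<^sub>K. g x \<in> g ` G}" by (rule *[OF GH(1)])
    also have "\<dots> = {x \<in> \<O>\<^sub>K. g x \<in> g ` H}" by (simp only: GH(3))
    also have "\<dots> = H" by (rule *[OF GH(2), symmetric])
    finally show "G = H" .
  qed
  moreover have "image g ` ?S \<subseteq> Pow (g ` \<O>\<^sub>K)" by blast
  ultimately show ?thesis
    using g(1) by (meson finite_Pow_iff finite_imageD finite_subset)
qed

text \<open>Since \<open>m\<O>\<^sub>K \<subseteq> R\<close>, an ideal containing \<open>N\<close>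
  contains \<open>mN\<O>\<^sub>K\<close>, so the count of subgroups applies.\<close>

lemma finite_ideals:
  assumes "(N::int) \<noteq> 0"
  shows "finite {J. ideal_in R J \<and> of_int N \<in> J}"
proof -
  obtain m :: int where m: "m \<noteq> 0" "\<And>x. x \<in> \<O>\<^sub>K \<Longrightarrow> of_int m * x \<in> R" using multiple by blast
  have mult: "of_int (m * N) * z \<in> J" if "ideal_in R J" "of_int N \<in> J" "z \<in> \<O>\<^sub>K" for J z
    using ideal_inD(4)[OF that(1) m(2)[OF that(3)] that(2)] by (simp add: mult_ac)
  have "{J. ideal_in R J \<and> of_int N \<in> J} \<subseteq>
    {G. G \<subseteq> \<O>\<^sub>K \<and> (\<forall>x\<in>G. \<forall>y\<in>G. x + y \<in> G) \<and> (\<forall>z\<in>\<O>\<^sub>K. of_int (m * N) * z \<in> G)}"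
  proof clarify
    fix J assume J: "ideal_in R J" "of_int N \<in> J"
    show "J \<subseteq> \<O>\<^sub>K \<and> (\<forall>x\<in>J. \<forall>y\<in>J. x + y \<in> J) \<and> (\<forall>z\<in>\<O>\<^sub>K. of_int (m * N) * z \<in> J)"
      using J mult[OF J] subset_integers unfolding ideal_in_def by blast
  qed
  then show ?thesis
    using finite_subgroups[of "m * N"] assms m(1) by (meson finite_subset mult_eq_0_iff)
qed

text \<open>In an integer polynomial with root \<open>a \<noteq> 0\<close>, powers of the variable
  can be cancelled until the constant term is nonzero; that term is then a multiple of
  \<open>a\<close>.\<close>

lemma divides_integer:
  assumes a: "a \<in> R" "a \<noteq> 0"
  shows "\<exists>N::int. N \<noteq> 0 \<and> (\<exists>b\<in>R. a * b = of_int N)"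
proof -
  have "algebraic_int a" using a subset_integers by (auto simp: ring_of_integers_def)
  then obtain p where p: "poly (map_poly of_int p) a = 0" "lead_coeff p = 1"
    unfolding algebraic_int_altdef_ipoly by blast
  then have "p \<noteq> 0" by auto
  then show ?thesis using p(1)
  proof (induction p)
    case 0
    then show ?case by simp
  next
    case (pCons c p)
    define b where "b = - poly (map_poly of_int p) a"
    have bR: "b \<in> R" unfolding b_def poly_altdef
      using a by (intro neg sum mult power) (auto simp: coeff_map_poly)
    have "of_int c = a * b" using pCons.prems(2)
      by (simp add: of_int_hom.map_poly_pCons_hom b_def eq_neg_iff_add_eq_0)
    then show ?case
    proof (cases "c = 0")
      case True
      then show ?thesis using \<open>of_int c = a * b\<close> a(2) pCons by (auto simp: b_def)
    next
      case False
      then show ?thesis using \<open>of_int c = a * b\<close> bR by metis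
    qed
  qed
qed

text \<open>Two powers of \<open>s\<close> fall into the same residue class. Residues are taken
  modulo \<open>N * m\<close> because the extra factor \<open>m\<close> moves the cofactor from
  \<open>\<O>\<^sub>K\<close> into \<open>R\<close>.\<close>

lemma power_repeats:
  assumes s: "s \<in> R" and N: "(N::int) \<noteq> 0"
  shows "\<exists>i k. k > 0 \<and> (\<exists>z\<in>R. s ^ i * (1 - s ^ k) = of_int N * z)"
proof -
  obtain m :: int where m: "m \<noteq> 0" "\<And>x. x \<in> \<O>\<^sub>K \<Longrightarrow> of_int m * x \<in> R" using multiple by blast
  obtain g :: "'k \<Rightarrow> 'k \<Rightarrow> int" where g: "finite (g ` \<O>\<^sub>K)"
    "\<And>x y. x \<in> \<O>\<^sub>K \<Longrightarrow> y \<in> \<O>\<^sub>K \<Longrightarrow> g x = g y \<Longrightarrow> \<exists>z\<in>\<O>\<^sub>K. x - y = of_int (N * m) * z"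
    using residues[of "N * m"] N m(1) by auto
  have sO: "s ^ n \<in> \<O>\<^sub>K" for n using s subset_integers by blast
  have "finite (range (\<lambda>n. g (s ^ n)))"
    by (rule finite_subset[OF _ g(1)]) (use sO in auto)
  then have "\<not> inj (\<lambda>n::nat. g (s ^ n))"
    using finite_imageD infinite_UNIV_nat by blast
  then obtain i j where "i \<noteq> j" "g (s ^ i) = g (s ^ j)" by (auto simp: inj_def)
  then obtain i j where ij: "i < j" "g (s ^ i) = g (s ^ j)" by (metis linorder_neqE_nat)
  then obtain z where z: "z \<in> \<O>\<^sub>K" "s ^ i - s ^ j = of_int (N * m) * z"
    using g(2)[OF sO sO] by blast
  have "s ^ j = s ^ i * s ^ (j - i)" using ij(1) by (simp flip: power_add)
  then have "s ^ i * (1 - s ^ (j - i)) = of_int N * (of_int m * z)"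
    using z(2) by (simp add: algebra_simps)
  then show ?thesis using m(2)[OF z(1)] ij(1) by (intro exI[of _ i] exI[of _ "j - i"]) auto
qed

lemma nonzero_ideal_contains_int:
  assumes "ideal_in R I" "I \<noteq> {0}"
  shows "\<exists>N::int. N \<noteq> 0 \<and> of_int N \<in> I"
proof -
  obtain a where a: "a \<in> I" "a \<noteq> 0" using assms ideal_inD(2) by blast
  then obtain N :: int and b where "N \<noteq> 0" "b \<in> R" "a * b = of_int N"
    using divides_integer ideal_inD(1)[OF assms(1)] by blast
  then show ?thesis using ideal_inD(5)[OF assms(1) \<open>b \<in> R\<close> a(1)] by auto
qed

text \<open>\<open>P\<close> contains a nonzero integer, so
  \<open>s ^ i * (1 - s ^ k) \<in> P\<close> for some \<open>k > 0\<close>. Primality removes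
  \<open>s ^ i\<close>, and \<open>s ^ (k - 1)\<close> is the inverse.\<close>

lemma nonzero_prime_inverse_modulo:
  assumes P: "prime_in R P" "P \<noteq> {0}" and s: "s \<in> R" "s \<notin> P"
  shows "\<exists>t\<in>R. 1 - s * t \<in> P"
proof -
  obtain N :: int where N: "N \<noteq> 0" "of_int N \<in> P"
    using nonzero_ideal_contains_int prime_inD(1) P by blast
  obtain i k z where k: "k > 0" "z \<in> R" "s ^ i * (1 - s ^ k) = of_int N * z"
    using power_repeats[OF s(1) N(1)] by blast
  then have "s ^ i * (1 - s ^ k) \<in> P"
    using ideal_inD(5)[OF prime_inD(1)[OF P(1)] k(2) N(2)] by simp
  moreover have "s ^ i \<notin> P" using prime_in_power[OF P(1) s(1)] s(2) by blast
  ultimately have "1 - s ^ k \<in> P"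
    using prime_inD(3)[OF P(1) power[OF s(1)] diff[OF one power[OF s(1)]]] by metis
  moreover have "s ^ k = s * s ^ (k - 1)" using k(1) by (metis power_eq_if neq0_conv)
  ultimately show ?thesis using s(1) by (intro bexI[of _ "s ^ (k - 1)"]) auto
qed

lemma nonzero_prime_maximal:
  assumes P: "prime_in R P" "P \<noteq> {0}" and Q: "prime_in R Q" "P \<subseteq> Q"
  shows "P = Q"
proof (rule ccontr)
  assume "P \<noteq> Q"
  then obtain s where s: "s \<in> Q" "s \<notin> P" using Q(2) by blast
  then have "s \<in> R" using ideal_inD(1) prime_inD(1) Q(1) by blast
  then obtain t where t: "t \<in> R" "1 - s * t \<in> P" using nonzero_prime_inverse_modulo[OF P] s by blast
  then have "s * t + (1 - s * t) \<in> Q"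
    using Q s(1) by (intro ideal_inD(3)[OF prime_inD(1)[OF Q(1)]] ideal_inD(5)[OF prime_inD(1)[OF Q(1)]]) auto
  then show False using prime_inD(2)[OF Q(1)] by simp
qed

text \<open>Only finitely many ideals contain \<open>N\<close>, so there is a maximal one among the
  proper ideals above \<open>I\<close>, and it is prime by the usual argument: if
  \<open>1 = r * a + p\<close>, then \<open>b = r * (a * b) + b * p\<close>.\<close>

lemma prime_above:
  assumes I: "ideal_in R I" "1 \<notin> I" and N: "(N::int) \<noteq> 0" "of_int N \<in> I"
  shows "\<exists>P. prime_in R P \<and> I \<subseteq> P"
proof -
  define S where "S = {J. ideal_in R J \<and> I \<subseteq> J \<and> 1 \<notin> J}"
  have "finite S"
    by (rule finite_subset[OF _ finite_ideals[OF N(1)]]) (use N(2) in \<open>auto simp: S_def\<close>)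
  moreover have "I \<in> S" using I by (simp add: S_def)
  ultimately obtain P where P: "P \<in> S" "\<And>J. J \<in> S \<Longrightarrow> P \<subseteq> J \<Longrightarrow> J = P"
    using finite_has_maximal[of S] by (metis empty_iff)
  have PI: "ideal_in R P" "I \<subseteq> P" "1 \<notin> P" using P(1) by (auto simp: S_def)
  have meets: "\<exists>r\<in>R. \<exists>p\<in>P. 1 = r * a + p" if a: "a \<in> R" "a \<notin> P" for a
  proof -
    define J where "J = {r * a + p | r p. r \<in> R \<and> p \<in> P}"
    have "P \<subseteq> J"
    proof
      fix p assume "p \<in> P"
      then have "0 * a + p \<in> J" unfolding J_def by blast
      then show "p \<in> J" by simp
    qed
    have "1 * a + 0 \<in> J" unfolding J_def using ideal_inD(2)[OF PI(1)] one by blast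
    then have "J \<noteq> P" using a(2) by auto
    have "ideal_in R J"
      unfolding ideal_in_def
    proof (intro conjI ballI)
      show "J \<subseteq> R" using a ideal_inD(1)[OF PI(1)] by (auto simp: J_def)
      show "0 \<in> J" using \<open>P \<subseteq> J\<close> ideal_inD(2)[OF PI(1)] by blast
    next
      fix x y assume "x \<in> J" "y \<in> J"
      then obtain r p r' p' where *: "x = r * a + p" "y = r' * a + p'" "r \<in> R" "r' \<in> R" "p \<in> P" "p' \<in> P"
        unfolding J_def by blast
      then have "x + y = (r + r') * a + (p + p')" by (simp add: algebra_simps)
      then show "x + y \<in> J" unfolding J_def using * ideal_inD(3)[OF PI(1)] by blast
    next
      fix t x assume "t \<in> R" "x \<in> J"
      then obtain r p where *: "x = r * a + p" "r \<in> R" "p \<in> P"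
        unfolding J_def by blast
      then have "t * x = (t * r) * a + t * p" by (simp add: algebra_simps)
      then show "t * x \<in> J" unfolding J_def using * \<open>t \<in> R\<close> ideal_inD(4)[OF PI(1)] by blast
    qed
    then have "1 \<in> J" using P(2)[of J] \<open>P \<subseteq> J\<close> \<open>J \<noteq> P\<close> PI(2) by (auto simp: S_def)
    then show ?thesis unfolding J_def by blast
  qed
  have "a \<in> P \<or> b \<in> P" if ab: "a \<in> R" "b \<in> R" "a * b \<in> P" for a b
  proof (rule ccontr)
    assume "\<not> ?thesis"
    then obtain r p where r: "r \<in> R" "p \<in> P" "1 = r * a + p" and nb: "b \<notin> P"
      using meets[OF ab(1)] by blast
    have "b = r * (a * b) + b * p" using r(3) by (metis mult.assoc mult.commute distrib_right mult_1)
    also have "\<dots> \<in> P"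
      using r ab by (intro ideal_inD(3)[OF PI(1) ideal_inD(4)[OF PI(1)] ideal_inD(4)[OF PI(1)]])
    finally show False using nb by simp
  qed
  then show ?thesis using PI by (auto simp: prime_in_def)
qed

end

text \<open>\<open>q\<close> is the least positive integer in \<open>P\<close>, which generates
  \<open>P \<inter> \<int>\<close> by division with remainder. It is not 1 because \<open>P\<close>
  is proper.\<close>

lemma (in field_subring) int_divisor_of_prime:
  assumes "prime_in R P" "(N::int) \<noteq> 0" "of_int N \<in> P"
  shows "\<exists>q::int. \<not> q dvd 1 \<and> (\<forall>k::int. of_int k \<in> P \<longrightarrow> q dvd k)"
proof -
  have I: "ideal_in R P" using prime_inD(1)[OF assms(1)] .
  have "\<bar>N\<bar> \<ge> 0 \<and> of_int \<bar>N\<bar> \<in> P"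
    using assms(3) ideal_in_minus[OF I] by (auto simp: abs_if)
  define S where "S = {k::nat. k > 0 \<and> of_nat k \<in> P}"
  have "nat \<bar>N\<bar> \<in> S" using assms(2) \<open>\<bar>N\<bar> \<ge> 0 \<and> _\<close> by (auto simp: S_def)
  define q where "q = (LEAST k. k \<in> S)"
  have q: "q \<in> S" unfolding q_def by (rule LeastI) fact
  have qmin: "k \<in> S \<Longrightarrow> q \<le> k" for k unfolding q_def by (rule Least_le)
  have dvd: "int q dvd k" if "of_int k \<in> P" for k :: int
  proof (rule ccontr)
    assume "\<not> int q dvd k"
    have "k mod int q \<ge> 0" using q by (auto simp: S_def)
    moreover have "k mod int q \<noteq> 0" using \<open>\<not> int q dvd k\<close> by (simp add: dvd_eq_mod_eq_0)
    ultimately have pos: "k mod int q > 0" by simp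
    have "of_int (k mod int q) \<in> P"
    proof -
      have "of_int (k mod int q) = of_int k - of_int (k div int q) * (of_nat q :: 'k)"
        by (metis minus_div_mult_eq_mod of_int_diff of_int_mult of_int_of_nat_eq)
      also have "\<dots> \<in> P" using that q by (intro ideal_in_diff[OF I] ideal_inD(4)[OF I]) (auto simp: S_def)
      finally show ?thesis .
    qed
    with pos have "nat (k mod int q) \<in> S" by (auto simp: S_def)
    then have "q \<le> nat (k mod int q)" by (rule qmin)
    moreover have "k mod int q < int q" using q by (simp add: S_def)
    ultimately show False using pos by linarith
  qed
  have "q \<noteq> 1" using q prime_inD(2)[OF assms(1)] by (auto simp: S_def)
  then show ?thesis using dvd by (intro exI[of _ "int q"]) auto
qed

section \<open>Regular primes of orders\<close>

locale order_prime = integer_order R + subring_prime R P for R :: "'k::field_char_0 set" and P +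
  assumes nonzero: "P \<noteq> {0}"
begin

text \<open>If \<open>R\<^sub>P\<close> contains \<open>\<O>\<^sub>K\<close>, a product of
  denominators of finitely many representatives of \<open>\<O>\<^sub>K\<close> modulo
  \<open>m\<close> carries all of \<open>\<O>\<^sub>K\<close> into \<open>R\<close>, since
  \<open>m\<O>\<^sub>K\<close> is already there. This product lies in the conductor but not in
  \<open>P\<close>. Conversely, a conductor element outside \<open>P\<close> is a common denominator
  for \<open>\<O>\<^sub>K\<close>.\<close>

lemma integers_subset_localization_iff: "\<O>\<^sub>K \<subseteq> V \<longleftrightarrow> \<not> cond \<subseteq> P"
proof
  assume "\<not> cond \<subseteq> P"
  then obtain s where s: "s \<in> cond" "s \<notin> P" by blast
  show "\<O>\<^sub>K \<subseteq> V"
  proof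
    fix x :: 'k assume "x \<in> \<O>\<^sub>K"
    then have "s * x \<in> R" using condD s by blast
    then show "x \<in> V" using s cond_subset unfolding in_localization_iff by blast
  qed
next
  assume OV: "\<O>\<^sub>K \<subseteq> V"
  obtain m :: int where m: "m \<noteq> 0" "\<And>x. x \<in> \<O>\<^sub>K \<Longrightarrow> of_int m * x \<in> R" using multiple by blast
  obtain g :: "'k \<Rightarrow> 'k \<Rightarrow> int" where g: "finite (g ` \<O>\<^sub>K)"
    "\<And>x y. x \<in> \<O>\<^sub>K \<Longrightarrow> y \<in> \<O>\<^sub>K \<Longrightarrow> g x = g y \<Longrightarrow> \<exists>z\<in>\<O>\<^sub>K. x - y = of_int m * z"
    using residues[OF m(1)] by blast
  obtain T where T: "finite T" "T \<subseteq> \<O>\<^sub>K" "g ` \<O>\<^sub>K = g ` T"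
    using finite_subset_image[OF g(1) subset_refl] by metis
  have "\<exists>s. s \<in> R - P \<and> s * t \<in> R" if "t \<in> T" for t
    using OV T(2) that in_localization_iff by blast
  then obtain s where s: "\<And>t. t \<in> T \<Longrightarrow> s t \<in> R - P" "\<And>t. t \<in> T \<Longrightarrow> s t * t \<in> R" by metis
  have sR: "s t \<in> R" if "t \<in> T" for t using s(1)[OF that] by simp
  define u where "u = prod s T"
  have uR: "u \<in> R" unfolding u_def by (rule prod[OF sR])
  have "u \<notin> P"
  proof
    assume "u \<in> P"
    then have "\<exists>t\<in>T. s t \<in> P" unfolding u_def
      by (rule prime_in_prod[OF T(1) prime, rotated]) (rule sR)
    then show False using s(1) by fastforce
  qed
  moreover have "u \<in> cond"
    unfolding cond_def
  proof (intro CollectI ballI)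
    fix x :: 'k assume x: "x \<in> \<O>\<^sub>K"
    then have "g x \<in> g ` T" using T(3) by blast
    then obtain t where t: "t \<in> T" "g x = g t" by blast
    then obtain z where z: "z \<in> \<O>\<^sub>K" "x - t = of_int m * z" using g(2)[OF x, of t] T(2) by blast
    have "u * t = prod s (T - {t}) * (s t * t)"
      unfolding u_def using prod.remove[OF T(1) t(1), of s] by (simp add: mult_ac)
    also have "\<dots> \<in> R" using sR by (intro mult[OF prod s(2)[OF t(1)]]) auto
    finally have "u * t \<in> R" .
    moreover have "u * (of_int m * z) \<in> R" using uR m(2)[OF z(1)] by (rule mult)
    ultimately have "u * t + u * (of_int m * z) \<in> R" by (rule add)
    then show "u * x \<in> R" using z(2) by (metis add.commute diff_add_cancel distrib_left)
  qed
  ultimately show "\<not> cond \<subseteq> P" by blast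
qed

text \<open>
  The quotient is a root of a primitive integer polynomial; as \<open>P\<close> contains no integers but
  multiples of a non-unit \<open>q\<close>, some coefficient lies outside \<open>P\<close>.
\<close>

lemma valuation_quotient:
  assumes OV: "\<O>\<^sub>K \<subseteq> V" and ab: "a \<in> R" "b \<in> R" "b \<noteq> 0"
  shows "a / b \<in> V \<or> b / a \<in> V"
proof -
  define x where "x = a / b"
  obtain N :: int and b' where N: "N \<noteq> 0" "b' \<in> R" "b * b' = of_int N"
    using divides_integer[OF ab(2,3)] by blast
  have "b' \<noteq> 0" using N by auto
  have "of_int N * x = a * b'" using N(3)[symmetric] ab(3) by (simp add: x_def)
  then have "of_int N * x \<in> \<O>\<^sub>K" using ab(1) N(2) subset_integers by (metis mult subsetD)
  then obtain p where p: "poly (map_poly of_int p) (of_int N * x) = 0" "lead_coeff p = 1"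
    by (auto simp: ring_of_integers_def algebraic_int_altdef_ipoly)
  \<comment> \<open>\<open>N * x\<close> is integral, so substituting \<open>N\<close> times the
    variable into its monic polynomial gives an integer polynomial with root \<open>x\<close>; its
    primitive part still has that root.\<close>
  define f where "f = pcompose p [:0, N:]"
  have f0: "f \<noteq> 0" using p(2) N(1) by (auto simp: f_def pcompose_eq_0_iff)
  have root: "poly (map_poly of_int f) x = 0"
    using p(1) by (simp add: f_def of_int_hom.map_poly_pcompose poly_pcompose mult.commute
        of_int_hom.map_poly_pCons_hom)
  have "map_poly of_int f = smult (of_int (content f) :: 'k) (map_poly of_int (primitive_part f))"
    by (metis content_times_primitive_part of_int_hom.map_poly_hom_smult)
  then have h: "poly (map_poly of_int (primitive_part f)) x = 0"
    using root f0 by simp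
  obtain k :: int where k: "k \<noteq> 0" "of_int k \<in> P"
    using nonzero_ideal_contains_int[OF prime_inD(1)[OF prime] nonzero] by blast
  obtain q :: int where q: "\<not> q dvd 1" "\<And>k::int. of_int k \<in> P \<Longrightarrow> q dvd k"
    using int_divisor_of_prime[OF prime k] by blast
  have "\<exists>j. of_int (Polynomial.coeff (primitive_part f) j) \<notin> P"
  proof (rule ccontr)
    assume "\<not> ?thesis"
    then have "q dvd Polynomial.coeff (primitive_part f) j" for j using q(2) by blast
    then have "[:q:] dvd primitive_part f" by (simp add: const_poly_dvd_iff)
    then have "q dvd content (primitive_part f)" by (simp add: const_poly_dvd_iff_dvd_content)
    then show False using q(1) f0 by simp
  qed
  then obtain j where "of_int (Polynomial.coeff (primitive_part f) j) \<notin> P" by blast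
  then have j: "of_int (Polynomial.coeff (primitive_part f) j) \<notin> local_maximal"
    using local_maximal_iff[OF of_int] by blast
  obtain c d where cd: "c \<in> \<O>\<^sub>K" "d \<in> \<O>\<^sub>K" "x * c \<in> \<O>\<^sub>K" "x * d \<in> \<O>\<^sub>K"
      "of_int (Polynomial.coeff (primitive_part f) j) = c - x * d"
    using horner_integral[OF h, of j] by blast
  then have cdV: "c \<in> V" "d \<in> V" "x * c \<in> V" "x * d \<in> V" using OV by blast+
  have "c \<notin> local_maximal \<or> x * d \<notin> local_maximal"
    using j unfolding cd(5) using loc.ideal_in_diff[OF ideal_local_maximal] by blast
  then show ?thesis
  proof
    assume "c \<notin> local_maximal"
    then have "c \<noteq> 0" "1 / c \<in> V" using unit_outside_local_maximal[OF cdV(1)] by blast+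
    then have "x * c * (1 / c) \<in> V" using loc.mult[OF cdV(3)] by blast
    then show ?thesis using \<open>c \<noteq> 0\<close> by (simp add: x_def)
  next
    assume "x * d \<notin> local_maximal"
    then have "x * d \<noteq> 0" "1 / (x * d) \<in> V" using unit_outside_local_maximal[OF cdV(4)] by blast+
    then have "d * (1 / (x * d)) \<in> V" using loc.mult[OF cdV(2)] by blast
    moreover have "d * (1 / (x * d)) = b / a" using \<open>x * d \<noteq> 0\<close> by (auto simp: x_def)
    ultimately show ?thesis by simp
  qed
qed

lemma valuation:
  assumes OV: "\<O>\<^sub>K \<subseteq> V" and uv: "u \<in> V" "v \<in> V" "v \<noteq> 0"
  shows "u / v \<in> V \<or> v / u \<in> V"
proof -
  obtain s t where st: "s \<in> R - P" "s * u \<in> R" "t \<in> R - P" "t * v \<in> R"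
    using uv(1,2) unfolding in_localization_iff by blast
  have 0: "s \<noteq> 0" "t \<noteq> 0" using st nonzero_denominator by blast+
  have "t * (s * u) \<in> R" "s * (t * v) \<in> R" using st by auto
  then have "t * (s * u) / (s * (t * v)) \<in> V \<or> s * (t * v) / (t * (s * u)) \<in> V"
    using 0 uv(3) by (intro valuation_quotient[OF OV]) auto
  moreover have "t * (s * u) / (s * (t * v)) = u / v" "s * (t * v) / (t * (s * u)) = v / u"
    using 0 by (auto simp: field_simps)
  ultimately show ?thesis by simp
qed

text \<open>A nonzero ideal \<open>I\<close> contains a nonzero integer \<open>N\<close>. Among the
  principal ideals inside \<open>I\<close> that contain \<open>N\<close>, one is chosen whose
  contraction to \<open>R\<close> is maximal. Any \<open>y\<close> in \<open>I\<close> is comparable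
  with its generator by the valuation property, and maximality settles the case in which
  \<open>y\<close> divides the generator.\<close>

lemma localization_principal:
  assumes OV: "\<O>\<^sub>K \<subseteq> V" and I: "ideal_in V I"
  shows "\<exists>a\<in>V. I = {x * a | x. x \<in> V}"
proof (cases "I = {0}")
  case True
  then show ?thesis by (intro bexI[of _ 0]) auto
next
  case False
  then obtain a where a: "a \<in> I" "a \<noteq> 0" using ideal_inD(2)[OF I] by blast
  have IV: "x \<in> I \<Longrightarrow> x \<in> V" for x using ideal_inD(1)[OF I] by blast
  obtain s where s: "s \<in> R - P" "s * a \<in> R" using IV[OF a(1)] in_localization_iff by blast
  have "s * a \<in> I" using s a(1) subset_localization ideal_inD(4)[OF I] by blast
  then have "s * a \<in> I \<inter> R" "s * a \<noteq> 0" using s a nonzero_denominator by auto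
  then obtain N :: int where N: "N \<noteq> 0" "of_int N \<in> I \<inter> R"
    using nonzero_ideal_contains_int[OF ideal_contraction[OF I]] by blast
  define pr where "pr y = {x * y | x. x \<in> V}" for y
  have pr_ideal: "ideal_in V (pr y)" if "y \<in> V" for y
    unfolding ideal_in_def
  proof (intro conjI ballI)
    show "pr y \<subseteq> V" using that by (auto simp: pr_def)
    have "0 * y \<in> pr y" unfolding pr_def by blast
    then show "0 \<in> pr y" by simp
  next
    fix b c assume "b \<in> pr y" "c \<in> pr y"
    then obtain b' c' where "b = b' * y" "c = c' * y" "b' \<in> V" "c' \<in> V" by (auto simp: pr_def)
    then have "b + c = (b' + c') * y" "b' + c' \<in> V" by (auto simp: distrib_right)
    then show "b + c \<in> pr y" unfolding pr_def by blast
  next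
    fix r b assume "r \<in> V" "b \<in> pr y"
    then obtain b' where "b = b' * y" "b' \<in> V" by (auto simp: pr_def)
    then have "r * b = (r * b') * y" "r * b' \<in> V" using \<open>r \<in> V\<close> by auto
    then show "r * b \<in> pr y" unfolding pr_def by blast
  qed
  have pr_self: "y \<in> pr y" for y
  proof -
    have "1 * y \<in> pr y" unfolding pr_def using loc.one by blast
    then show ?thesis by simp
  qed
  have pr_sub: "pr y \<subseteq> J" if "ideal_in V J" "y \<in> J" for y J
    using that ideal_inD(4) by (auto simp: pr_def)
  \<comment> \<open>Contractions are compared, since these are ideals of \<open>R\<close> containing
    \<open>N\<close> and hence finite in number. The family is nonempty because \<open>N\<close>
    itself may serve as \<open>y\<close>.\<close>
  define C where "C = (\<lambda>y. pr y \<inter> R) ` {y \<in> I. of_int N \<in> pr y}"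
  have "C \<subseteq> {J. ideal_in R J \<and> of_int N \<in> J}"
  proof
    fix J assume "J \<in> C"
    then obtain y where "y \<in> I" "of_int N \<in> pr y" "J = pr y \<inter> R" by (auto simp: C_def)
    then show "J \<in> {J. ideal_in R J \<and> of_int N \<in> J}"
      using ideal_contraction[OF pr_ideal[OF IV]] by auto
  qed
  then have "finite C" using finite_ideals[OF N(1)] finite_subset by blast
  moreover have "pr (of_int N) \<inter> R \<in> C" unfolding C_def using N(2) pr_self by blast
  ultimately obtain M where M: "M \<in> C" "\<And>J. J \<in> C \<Longrightarrow> M \<subseteq> J \<Longrightarrow> J = M"
    using finite_has_maximal[of C] by (metis empty_iff)
  then obtain x where x: "x \<in> I" "of_int N \<in> pr x" "M = pr x \<inter> R" by (auto simp: C_def)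
  have xV: "x \<in> V" by (rule IV[OF x(1)])
  have "I \<subseteq> pr x"
  proof
    fix y assume y: "y \<in> I"
    show "y \<in> pr x"
    proof (cases "y / x \<in> V \<and> x \<noteq> 0 \<or> y = 0")
      case True
      then show ?thesis
      proof
        assume "y / x \<in> V \<and> x \<noteq> 0"
        then have "y / x * x \<in> pr x" "x \<noteq> 0" unfolding pr_def by blast+
        then show ?thesis by simp
      next
        assume "y = 0"
        then show ?thesis using ideal_inD(2)[OF pr_ideal[OF xV]] by simp
      qed
    next
      case False
      then have y0: "y \<noteq> 0" by blast
      have x0: "x \<noteq> 0"
      proof
        assume "x = 0"
        then have "of_int N = (0::'k)" using x(2) by (auto simp: pr_def)
        then show False using N(1) by simp
      qed
      then have "x / y \<in> V" using valuation[OF OV xV IV[OF y] y0] False by blast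
      then have "x / y * y \<in> pr y" unfolding pr_def by blast
      then have "x \<in> pr y" using y0 by simp
      then have sub: "pr x \<subseteq> pr y" using pr_sub[OF pr_ideal[OF IV[OF y]]] by blast
      then have "pr y \<inter> R \<in> C" using x(2) y unfolding C_def by blast
      moreover have "M \<subseteq> pr y \<inter> R" using sub x(3) by blast
      ultimately have eq: "pr y \<inter> R = pr x \<inter> R" using M(2) x(3) by blast
      \<comment> \<open>Equal contractions suffice: \<open>t * y\<close> lies in \<open>R\<close>,
        so it passes to the other principal ideal, and \<open>t\<close> is invertible in
        \<open>V\<close>.\<close>
      obtain t where t: "t \<in> R - P" "t * y \<in> R" using IV[OF y] in_localization_iff by blast
      have "t * y \<in> pr y" using t(1) subset_localization unfolding pr_def by blast
      then have "t * y \<in> pr x" using t(2) eq by blast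
      then have "1 / t * (t * y) \<in> pr x"
        by (rule ideal_inD(4)[OF pr_ideal[OF xV] inverse_denominator[OF t(1)]])
      then show ?thesis using nonzero_denominator[OF t(1)] by simp
    qed
  qed
  moreover have "pr x \<subseteq> I" by (rule pr_sub[OF I x(1)])
  ultimately show ?thesis using xV unfolding pr_def by blast
qed

text \<open>Clearing a denominator shows that \<open>Q\<close> has nonzero contraction; this
  contraction lies in \<open>P\<close> and equals it because nonzero primes of \<open>R\<close> are
  maximal. Extending back gives \<open>local_maximal \<subseteq> Q\<close>.\<close>

lemma localization_prime_unique:
  assumes Q: "prime_in V Q" "Q \<noteq> {0}"
  shows "Q = local_maximal"
proof
  have QI: "ideal_in V Q" using prime_inD[OF Q(1)] by blast
  show sub: "Q \<subseteq> local_maximal"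
    by (rule proper_ideal_subset_local_maximal[OF QI prime_inD(2)[OF Q(1)]])
  obtain q where q: "q \<in> Q" "q \<noteq> 0" using Q(2) ideal_inD(2)[OF QI] by blast
  then obtain s where s: "s \<in> R - P" "s * q \<in> R"
    using ideal_inD(1)[OF QI] in_localization_iff by blast
  have "s * q \<in> Q" using s q(1) subset_localization ideal_inD(4)[OF QI] by blast
  then have "s * q \<in> Q \<inter> R" "s * q \<noteq> 0" using s(2) q(2) nonzero_denominator[OF s(1)] by auto
  then have "Q \<inter> R \<noteq> {0}" by blast
  moreover have "Q \<inter> R \<subseteq> P" using sub local_maximal_iff by blast
  ultimately have "Q \<inter> R = P"
    using nonzero_prime_maximal[OF prime_contraction[OF Q(1)] _ prime] by blast
  show "local_maximal \<subseteq> Q"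
  proof
    fix x assume "x \<in> local_maximal"
    then obtain t where t: "t \<in> R - P" "t * x \<in> P" using in_local_maximal_iff by blast
    then have "1 / t * (t * x) \<in> Q"
      using \<open>Q \<inter> R = P\<close> by (intro ideal_inD(4)[OF QI inverse_denominator]) auto
    then show "x \<in> Q" using nonzero_denominator[OF t(1)] by simp
  qed
qed

text \<open>From right to left, the valuation property makes all ideals principal. From left to
  right, this is integral closedness of a principal ideal domain: in lowest terms
  \<open>x = a' / b'\<close> one of \<open>a'\<close> and \<open>b'\<close> is a unit of the local
  ring. If it is \<open>b'\<close>, then \<open>x\<close> lies in \<open>V\<close>; if it is
  \<open>a'\<close>, then \<open>1 / x\<close> does, and integrality of \<open>x\<close> brings
  \<open>x\<close> back.\<close>

lemma discrete_valuation_ring_localization_iff: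
  "discrete_valuation_ring (ring_on V) \<longleftrightarrow> \<O>\<^sub>K \<subseteq> V"
proof
  assume OV: "\<O>\<^sub>K \<subseteq> V"
  have "principal_domain (ring_on V)"
  proof (intro principal_domain.intro principal_domain_axioms.intro loc.domain_ring_on)
    fix I assume "ideal I (ring_on V)"
    then show "\<exists>a\<in>carrier (ring_on V). I = PIdl\<^bsub>ring_on V\<^esub> a"
      using localization_principal[OF OV] by (simp add: loc.ideal_ring_on_iff cgenideal_def)
  qed
  moreover have "P \<subseteq> local_maximal" using local_maximal_iff ideal_inD(1)[OF prime_inD(1)[OF prime]] by blast
  then have "local_maximal \<noteq> {0}" using nonzero ideal_inD(2)[OF prime_inD(1)[OF prime]] by blast
  then have "\<exists>!Q. prime_in V Q \<and> Q \<noteq> {0}"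
    using prime_local_maximal localization_prime_unique by blast
  ultimately show "discrete_valuation_ring (ring_on V)"
    by (simp add: discrete_valuation_ring_def loc.primeideal_ring_on_iff)
next
  assume "discrete_valuation_ring (ring_on V)"
  then interpret principal_domain "ring_on V" by (simp add: discrete_valuation_ring_def)
  obtain m :: int where m: "m \<noteq> 0" "\<And>x. x \<in> \<O>\<^sub>K \<Longrightarrow> of_int m * x \<in> R" using multiple by blast
  show "\<O>\<^sub>K \<subseteq> V"
  proof
    fix x :: 'k assume x: "x \<in> \<O>\<^sub>K"
    define a where "a = of_int m * x"
    have aV: "a \<in> V" using m(2)[OF x] subset_localization by (auto simp: a_def)
    \<comment> \<open>The ideal generated by numerator and denominator of \<open>x = a / m\<close>;
      its generator \<open>d\<close> is their greatest common divisor, with Bezout identity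
      \<open>r * a' + t * b' = 1\<close>.\<close>
    define I where "I = {r * a + t * of_int m | r t. r \<in> V \<and> t \<in> V}"
    have "ideal_in V I"
      unfolding ideal_in_def
    proof (intro conjI ballI)
      show "I \<subseteq> V" using aV by (auto simp: I_def)
      have "0 * a + 0 * of_int m \<in> I" unfolding I_def using loc.zero by blast
      then show "0 \<in> I" by simp
    next
      fix y z assume "y \<in> I" "z \<in> I"
      then obtain r t r' t' where *: "y = r * a + t * of_int m" "z = r' * a + t' * of_int m"
        "r \<in> V" "t \<in> V" "r' \<in> V" "t' \<in> V" unfolding I_def by blast
      then have "y + z = (r + r') * a + (t + t') * of_int m" by (simp add: algebra_simps)
      then show "y + z \<in> I" unfolding I_def using loc.add[OF *(3,5)] loc.add[OF *(4,6)] by blast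
    next
      fix u y assume "u \<in> V" "y \<in> I"
      then obtain r t where *: "y = r * a + t * of_int m" "r \<in> V" "t \<in> V" unfolding I_def by blast
      then have "u * y = (u * r) * a + (u * t) * of_int m" by (simp add: algebra_simps)
      then show "u * y \<in> I" unfolding I_def using loc.mult[OF \<open>u \<in> V\<close>] * by blast
    qed
    then obtain d where d: "d \<in> V" "I = {z * d | z. z \<in> V}"
      using exists_gen[of I] by (auto simp: loc.ideal_ring_on_iff cgenideal_def)
    have "1 * a + 0 * of_int m \<in> I" "0 * a + 1 * of_int m \<in> I"
      unfolding I_def using loc.zero loc.one by blast+
    then have "a \<in> I" "of_int m \<in> I" by simp_all
    then obtain a' b' where ab: "a = a' * d" "of_int m = b' * d" "a' \<in> V" "b' \<in> V" unfolding d(2) by blast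
    have d0: "d \<noteq> 0" using ab(2) m(1) by auto
    have "1 * d \<in> I" unfolding d(2) using loc.one by blast
    then obtain r t where rt: "d = r * a + t * of_int m" "r \<in> V" "t \<in> V" unfolding I_def by auto
    then have "d = (r * a' + t * b') * d" using ab by (simp add: algebra_simps)
    then have unit: "r * a' + t * b' = 1" using d0 by simp
    have xq: "x * b' = a'"
      using ab d0 by (simp add: a_def) (metis mult.commute mult.left_commute mult_cancel_left)
    have "a' \<notin> local_maximal \<or> b' \<notin> local_maximal"
    proof (rule ccontr)
      assume "\<not> ?thesis"
      then have "r * a' + t * b' \<in> local_maximal"
        using rt(2,3) by (intro ideal_inD(3)[OF ideal_local_maximal ideal_inD(4)[OF ideal_local_maximal]
            ideal_inD(4)[OF ideal_local_maximal]]) auto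
      then show False using unit one_notin_local_maximal by simp
    qed
    then show "x \<in> V"
    proof
      assume "b' \<notin> local_maximal"
      then have "b' \<noteq> 0" "1 / b' \<in> V" using unit_outside_local_maximal[OF ab(4)] by blast+
      then have "a' * (1 / b') \<in> V" using loc.mult[OF ab(3)] by blast
      then show ?thesis using \<open>b' \<noteq> 0\<close> by (simp flip: xq)
    next
      assume "a' \<notin> local_maximal"
      then have "a' \<noteq> 0" "1 / a' \<in> V" using unit_outside_local_maximal[OF ab(3)] by blast+
      then have "b' * (1 / a') \<in> V" using loc.mult[OF ab(4)] by blast
      moreover have "b' * (1 / a') = 1 / x" using \<open>a' \<noteq> 0\<close> by (auto simp flip: xq)
      ultimately show ?thesis
        using x algebraic_int_in_ring_if_inverse[OF field_subring_localization, of x]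
        by (simp add: ring_of_integers_def)
    qed
  qed
qed

end

context integer_order
begin

text \<open>The zero ideal drops out on the right because the conductor contains a nonzero
  integer.\<close>

lemma singular_primes_iff: "P \<in> singular_primes R \<longleftrightarrow> prime_in R P \<and> cond \<subseteq> P"
proof (cases "prime_in R P \<and> P \<noteq> {0}")
  case True
  then interpret order_prime R P by unfold_locales auto
  show ?thesis
    using True discrete_valuation_ring_localization_iff integers_subset_localization_iff
    by (simp add: singular_primes_def nonzero_primes_iff)
next
  case False
  obtain m :: int where "m \<noteq> 0" "of_int m \<in> cond" using int_in_cond by blast
  then have "\<not> cond \<subseteq> {0}" by auto
  then show ?thesis using False by (auto simp: singular_primes_def nonzero_primes_iff)
qed

end

section \<open>Local components\<close>

lemma prime_in_restrict:
  assumes "field_subring C" "C \<subseteq> D" "prime_in D M"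
  shows "prime_in C (M \<inter> C)"
proof -
  interpret field_subring C by fact
  show ?thesis
    using assms(2,3) one mult add zero unfolding prime_in_def ideal_in_def by (auto; blast)
qed

text \<open>\<open>g\<close> may be any element of the field. For \<open>I = R\<close> this is the
  ideal of denominators of \<open>g\<close>, for \<open>I = cond\<close> the annihilator of
  \<open>g\<close> modulo the conductor.\<close>

lemma (in field_subring) ideal_colon: "ideal_in R I \<Longrightarrow> ideal_in R {x \<in> R. g * x \<in> I}"
  by (auto simp: ideal_in_def distrib_left mult.left_commute[of g])

lemma (in field_subring) ideal_self: "ideal_in R R"
  by (auto simp: ideal_in_def)

context integer_order
begin

lemma superring_order:
  assumes "field_subring A" "R \<subseteq> A" "A \<subseteq> \<O>\<^sub>K"
  shows "integer_order A"
proof -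
  interpret A: field_subring A by fact
  show ?thesis
  proof
    show "\<exists>m::int. m \<noteq> 0 \<and> (\<forall>x\<in>\<O>\<^sub>K. of_int m * x \<in> A)"
      using multiple assms(2) by blast
  qed (use assms(3) residues in blast)+
qed

lemma conductor_mono: "integer_order A \<Longrightarrow> R \<subseteq> A \<Longrightarrow> conductor R \<subseteq> conductor A"
  unfolding conductor_eq integer_order.conductor_eq cond_def integer_order.cond_def by blast

lemma in_conductor_iff: "x \<in> conductor R \<longleftrightarrow> (\<forall>y\<in>\<O>\<^sub>K. x * y \<in> R)"
  unfolding conductor_eq cond_def by blast

lemma finite_singular_primes: "finite (singular_primes R)"
proof -
  obtain m :: int where m: "m \<noteq> 0" "of_int m \<in> cond" using int_in_cond by blast
  have "singular_primes R \<subseteq> {J. ideal_in R J \<and> of_int m \<in> J}"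
    using m(2) by (auto simp: singular_primes_iff prime_in_def)
  then show ?thesis using finite_ideals[OF m(1)] finite_subset by blast
qed

lemma singular_primeD:
  assumes "P \<in> singular_primes R"
  shows "prime_in R P" "cond \<subseteq> P" "ideal_in R P" "1 \<notin> P" "P \<noteq> {0}" "P \<subseteq> R"
  using assms singular_primes_iff[of P] prime_inD[of R P] ideal_inD(1)[of R P]
  by (auto simp: singular_primes_def nonzero_primes_def)

lemma singular_prime_above:
  assumes J: "ideal_in R J" "cond \<subseteq> J" "1 \<notin> J"
  shows "\<exists>P\<in>singular_primes R. J \<subseteq> P"
proof -
  obtain m :: int where m: "m \<noteq> 0" "of_int m \<in> cond" using int_in_cond by blast
  then obtain P where "prime_in R P" "J \<subseteq> P" using prime_above[OF J(1,3) m(1)] J(2) by blast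
  then show ?thesis using J(2) singular_primes_iff by blast
qed

section \<open>Idempotents modulo the conductor\<close>

lemma idempotent_power_modulo_cond:
  assumes s: "s \<in> R"
  shows "\<exists>n>0. s ^ n * (1 - s ^ n) \<in> cond"
proof -
  obtain m :: int where m: "m \<noteq> 0" "of_int m \<in> cond" using int_in_cond by blast
  obtain i k z where k: "k > 0" "z \<in> R" "s ^ i * (1 - s ^ k) = of_int m * z"
    using power_repeats[OF s m(1)] by blast
  then have c: "s ^ i * (1 - s ^ k) \<in> cond" using ideal_inD(5)[OF ideal_cond k(2) m(2)] by simp
  \<comment> \<open>A multiple of \<open>k\<close> that is at least \<open>i\<close>:
    \<open>s ^ i\<close> divides \<open>s ^ n\<close>, and \<open>1 - s ^ k\<close> divides
    \<open>1 - s ^ n\<close>.\<close>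
  define n where "n = k * Suc i"
  have "i \<le> n" using k(1) by (cases k) (auto simp: n_def)
  then have "s ^ n = s ^ (n - i) * s ^ i" by (simp flip: power_add)
  moreover have "1 - s ^ n = (1 - s ^ k) * (\<Sum>j<Suc i. (s ^ k) ^ j)"
    unfolding n_def power_mult by (rule one_diff_power_eq)
  ultimately have "s ^ n * (1 - s ^ n) = (s ^ (n - i) * (\<Sum>j<Suc i. (s ^ k) ^ j)) * (s ^ i * (1 - s ^ k))"
    by (simp only: mult_ac)
  also have "\<dots> \<in> cond"
    by (intro ideal_inD(4)[OF ideal_cond _ c] mult[OF power sum] power s)
  finally show ?thesis using k(1) by (intro exI[of _ n]) (auto simp: n_def)
qed

lemma idempotent_product_modulo_cond:
  assumes "e \<in> R" "f \<in> R" "e * (1 - e) \<in> cond" "f * (1 - f) \<in> cond"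
  shows "(e * f) * (1 - e * f) \<in> cond"
proof -
  have "(e * f) * (1 - e * f) = f * (e * (1 - e)) + (e * e) * (f * (1 - f))"
    by (simp add: algebra_simps)
  also have "\<dots> \<in> cond"
    by (rule ideal_inD(3)[OF ideal_cond ideal_inD(4)[OF ideal_cond assms(2,3)]
        ideal_inD(4)[OF ideal_cond mult[OF assms(1,1)] assms(4)]])
  finally show ?thesis .
qed

text \<open>If \<open>g\<close> were not in the conductor, its annihilator modulo the conductor
  would be proper and so lie in a singular prime. That prime would contain \<open>1 - g\<close> by
  idempotence and \<open>g\<close> by assumption.\<close>

lemma idempotent_in_cond:
  assumes g: "g \<in> R" "g * (1 - g) \<in> cond" "\<And>P. P \<in> singular_primes R \<Longrightarrow> g \<in> P"
  shows "g \<in> cond"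
proof (rule ccontr)
  assume "g \<notin> cond"
  define J where "J = {x \<in> R. g * x \<in> cond}"
  have "ideal_in R J" unfolding J_def by (rule ideal_colon[OF ideal_cond])
  moreover have "cond \<subseteq> J"
    using cond_subset ideal_inD(4)[OF ideal_cond g(1)] by (auto simp: J_def)
  moreover have "1 \<notin> J" using \<open>g \<notin> cond\<close> by (simp add: J_def)
  ultimately obtain P where P: "P \<in> singular_primes R" "J \<subseteq> P" using singular_prime_above by blast
  have "1 - g \<in> J" using g(1,2) diff[OF one g(1)] by (simp add: J_def)
  then have "(1 - g) + g \<in> P"
    using P(2) g(3)[OF P(1)] by (intro ideal_inD(3)[OF singular_primeD(3)[OF P(1)]]) auto
  then show False using singular_primeD(4)[OF P(1)] by simp
qed

text \<open>Singular primes are pairwise incomparable, being maximal. A product of elements, one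
  from each other prime and none in \<open>P\<close>, separates \<open>P\<close> from the rest, and
  a suitable positive power of it is idempotent modulo the conductor.\<close>

lemma separating_idempotent_exists:
  assumes S: "P \<in> singular_primes R"
  shows "\<exists>e\<in>R. e * (1 - e) \<in> cond \<and> e \<notin> P \<and> (\<forall>P'\<in>singular_primes R. P' \<noteq> P \<longrightarrow> e \<in> P')"
proof -
  let ?S = "singular_primes R - {P}"
  have "\<exists>x. x \<in> P' \<and> x \<notin> P" if "P' \<in> ?S" for P'
    using nonzero_prime_maximal[of P' P] singular_primeD[of P'] singular_primeD[OF S] that by blast
  then obtain f where f: "\<And>P'. P' \<in> ?S \<Longrightarrow> f P' \<in> P'" "\<And>P'. P' \<in> ?S \<Longrightarrow> f P' \<notin> P" by metis
  have fR: "f P' \<in> R" if "P' \<in> ?S" for P' using f(1)[OF that] singular_primeD(6)[of P'] that by blast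
  have fin: "finite ?S" using finite_singular_primes by simp
  define x where "x = prod f ?S"
  have xR: "x \<in> R" unfolding x_def by (rule prod) (rule fR)
  have xP: "x \<notin> P"
  proof
    assume "x \<in> P"
    then have "\<exists>P'\<in>?S. f P' \<in> P" unfolding x_def
      by (rule prime_in_prod[OF fin singular_primeD(1)[OF S], rotated]) (rule fR)
    then show False using f(2) by blast
  qed
  have xP': "x \<in> P'" if "P' \<in> ?S" for P'
  proof -
    have "x = prod f (?S - {P'}) * f P'"
      unfolding x_def using prod.remove[OF fin that, of f] by (simp add: mult_ac)
    moreover have "prod f (?S - {P'}) \<in> R" by (rule prod) (use fR in blast)
    ultimately show ?thesis using ideal_inD(4)[OF singular_primeD(3)[of P']] f(1)[OF that] that by simp
  qed
  obtain n where n: "n > 0" "x ^ n * (1 - x ^ n) \<in> cond" using idempotent_power_modulo_cond[OF xR] by blast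
  have "x ^ n \<notin> P" using prime_in_power[OF singular_primeD(1)[OF S] xR] xP by blast
  moreover have "x ^ n \<in> P'" if "P' \<in> singular_primes R" "P' \<noteq> P" for P'
  proof -
    have "x ^ n = x ^ (n - 1) * x" using n(1) by (metis power_eq_if mult.commute neq0_conv)
    then show ?thesis
      using ideal_inD(4)[OF singular_primeD(3)[OF that(1)] power[OF xR] xP'] that by simp
  qed
  ultimately show ?thesis using n(2) power[OF xR] by blast
qed

text \<open>A lift to \<open>R\<close> of the primitive idempotent of \<open>R/cond\<close> that belongs to \<open>P\<close>.\<close>

definition idem :: "'k set \<Rightarrow> 'k" where
  "idem P = (SOME e. e \<in> R \<and> e * (1 - e) \<in> cond \<and> e \<notin> P \<and>
     (\<forall>P'\<in>singular_primes R. P' \<noteq> P \<longrightarrow> e \<in> P'))"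

lemma idem:
  assumes S: "P \<in> singular_primes R"
  shows "idem P \<in> R" "idem P * (1 - idem P) \<in> cond" "idem P \<notin> P"
    "P' \<in> singular_primes R \<Longrightarrow> P' \<noteq> P \<Longrightarrow> idem P \<in> P'"
proof -
  have "idem P \<in> R \<and> idem P * (1 - idem P) \<in> cond \<and> idem P \<notin> P \<and>
     (\<forall>P'\<in>singular_primes R. P' \<noteq> P \<longrightarrow> idem P \<in> P')"
    unfolding idem_def by (rule someI_ex) (use separating_idempotent_exists[OF S] in blast)
  then show "idem P \<in> R" "idem P * (1 - idem P) \<in> cond" "idem P \<notin> P"
    "P' \<in> singular_primes R \<Longrightarrow> P' \<noteq> P \<Longrightarrow> idem P \<in> P'" by blast+
qed

text \<open>The product is idempotent modulo the conductor and lies in every singular prime, since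
  each of these differs from \<open>P\<close> or from \<open>P'\<close>.\<close>

lemma idem_orthogonal:
  assumes "P \<in> singular_primes R" "P' \<in> singular_primes R" "P \<noteq> P'"
  shows "idem P * idem P' \<in> cond"
proof (rule idempotent_in_cond)
  show "idem P * idem P' \<in> R" using idem(1) assms by blast
  show "idem P * idem P' * (1 - idem P * idem P') \<in> cond"
    using idempotent_product_modulo_cond idem(1,2) assms by blast
  fix Q assume Q: "Q \<in> singular_primes R"
  show "idem P * idem P' \<in> Q"
    using ideal_inD(4)[OF singular_primeD(3)[OF Q] idem(1)[OF assms(1)], of "idem P'"]
      ideal_inD(5)[OF singular_primeD(3)[OF Q] idem(1)[OF assms(2)], of "idem P"]
      idem(4)[OF assms(1) Q] idem(4)[OF assms(2) Q] assms(3) by metis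
qed

lemma order_prime_singular: "P \<in> singular_primes R \<Longrightarrow> order_prime R P"
  by unfold_locales (auto dest: singular_primeD)

text \<open>\<open>idem P\<close> is itself an admissible denominator. Conversely, let
  \<open>f\<close> be an idempotent power of a denominator \<open>s\<close> of \<open>x\<close>.
  Then \<open>1 - f\<close> lies in \<open>P\<close>, so \<open>idem P * (1 - f)\<close> lies in
  every singular prime and hence in the conductor, while \<open>f * x\<close> lies in
  \<open>R\<close>. One denominator thus serves the whole component.\<close>

lemma local_component_eq:
  assumes S: "P \<in> singular_primes R"
  shows "local_component R P = {x \<in> \<O>\<^sub>K. idem P * x \<in> R}"
proof -
  interpret order_prime R P by (rule order_prime_singular[OF S])
  show ?thesis
  proof (intro equalityI subsetI)
    fix x assume "x \<in> {x \<in> \<O>\<^sub>K. idem P * x \<in> R}"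
    then show "x \<in> local_component R P"
      using idem(1,3)[OF S] unfolding local_component_def in_localization_iff[of x] Int_iff by blast
  next
    fix x assume "x \<in> local_component R P"
    then have x: "x \<in> \<O>\<^sub>K" "x \<in> V" by (auto simp: local_component_def)
    obtain s where s: "s \<in> R" "s \<notin> P" "s * x \<in> R" using x(2) in_localization_iff by blast
    obtain n where n: "n > 0" "s ^ n * (1 - s ^ n) \<in> cond" using idempotent_power_modulo_cond[OF s(1)] by blast
    define f where "f = s ^ n"
    have fR: "f \<in> R" unfolding f_def by (rule power[OF s(1)])
    have gR: "1 - f \<in> R" by (rule diff[OF one fR])
    have fx: "f * x \<in> R"
    proof -
      have "f * x = s ^ (n - 1) * (s * x)" using n(1) unfolding f_def
        by (metis power_eq_if mult.assoc mult.commute neq0_conv)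
      then show ?thesis using mult[OF power[OF s(1)] s(3)] by (simp only:)
    qed
    have fP: "f \<notin> P" using prime_in_power[OF prime s(1)] s(2) unfolding f_def by blast
    have gP: "1 - f \<in> P"
      using n(2) singular_primeD(2)[OF S] prime_inD(3)[OF prime fR gR] fP unfolding f_def by blast
    have gi: "(1 - f) * (1 - (1 - f)) \<in> cond" using n(2) by (simp add: f_def mult.commute)
    have "idem P * (1 - f) \<in> cond"
    proof (rule idempotent_in_cond)
      show "idem P * (1 - f) \<in> R" using mult[OF idem(1)[OF S] gR] .
      show "idem P * (1 - f) * (1 - idem P * (1 - f)) \<in> cond"
        by (rule idempotent_product_modulo_cond[OF idem(1)[OF S] gR idem(2)[OF S] gi])
      fix Q assume Q: "Q \<in> singular_primes R"
      show "idem P * (1 - f) \<in> Q"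
        using ideal_inD(4)[OF singular_primeD(3)[OF Q] idem(1)[OF S], of "1 - f"]
          ideal_inD(5)[OF singular_primeD(3)[OF Q] gR, of "idem P"] idem(4)[OF S Q] gP by metis
    qed
    then have "idem P * (1 - f) * x \<in> R" using x(1) by (rule condD)
    moreover have "idem P * (f * x) \<in> R" using mult[OF idem(1)[OF S] fx] .
    ultimately have "idem P * (1 - f) * x + idem P * (f * x) \<in> R" by (rule add)
    then show "x \<in> {x \<in> \<O>\<^sub>K. idem P * x \<in> R}" using x(1) by (simp add: algebra_simps)
  qed
qed

lemma local_component_order:
  assumes S: "P \<in> singular_primes R"
  shows "integer_order (local_component R P)" "R \<subseteq> local_component R P" "local_component R P \<subseteq> \<O>\<^sub>K"
proof -
  interpret order_prime R P by (rule order_prime_singular[OF S])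
  have "field_subring (local_component R P)"
    unfolding local_component_def
    by unfold_locales (auto intro: loc.diff loc.mult integers.diff integers.mult)
  moreover show "R \<subseteq> local_component R P"
    using subset_localization subset_integers by (simp add: local_component_def)
  moreover show "local_component R P \<subseteq> \<O>\<^sub>K" by (simp add: local_component_def)
  ultimately show "integer_order (local_component R P)" by (rule superring_order)
qed

text \<open>By the description of the component through \<open>idem P\<close>, this amounts to
  \<open>idem P * (1 - idem P)\<close> carrying \<open>\<O>\<^sub>K\<close> into
  \<open>R\<close>.\<close>

lemma complement_idem_in_conductor:
  assumes S: "P \<in> singular_primes R"
  shows "1 - idem P \<in> conductor (local_component R P)"
proof -
  interpret C: integer_order "local_component R P" by (rule local_component_order[OF S])
  have "(1 - idem P) * y \<in> local_component R P" if y: "y \<in> \<O>\<^sub>K" for y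
  proof -
    have "1 - idem P \<in> \<O>\<^sub>K" using idem(1)[OF S] subset_integers by blast
    then have "(1 - idem P) * y \<in> \<O>\<^sub>K" using y by (rule integers.mult)
    moreover have "idem P * ((1 - idem P) * y) \<in> R"
      using condD[OF idem(2)[OF S] y] by (simp add: mult.assoc)
    ultimately show ?thesis unfolding local_component_eq[OF S] by blast
  qed
  then show ?thesis unfolding C.in_conductor_iff by blast
qed

text \<open>\<open>Q\<close> is the contraction of the maximal ideal of \<open>R\<^sub>P\<close>.
  Elements of the component outside \<open>Q\<close> are units of \<open>R\<^sub>P\<close>, so
  localizing at \<open>Q\<close> adds nothing to \<open>R\<^sub>P\<close>; nothing is lost because
  \<open>R\<close> lies in the component and \<open>Q \<inter> R = P\<close>.\<close>

lemma localization_local_component: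
  assumes S: "P \<in> singular_primes R"
  defines "Q \<equiv> subring_prime.local_maximal R P \<inter> local_component R P"
  shows "prime_in (local_component R P) Q" "Q \<noteq> {0}"
    "localization (local_component R P) Q = localization R P" "Q \<inter> R = P"
proof -
  interpret order_prime R P by (rule order_prime_singular[OF S])
  let ?C = "local_component R P"
  interpret C: integer_order ?C by (rule local_component_order[OF S])
  have CV: "?C \<subseteq> V" by (simp add: local_component_def)
  have RC: "R \<subseteq> ?C" by (rule local_component_order[OF S])
  show pr: "prime_in ?C Q"
    unfolding Q_def by (rule prime_in_restrict[OF C.field_subring_axioms CV prime_local_maximal])
  show QR: "Q \<inter> R = P"
    using local_maximal_iff RC singular_primeD(6)[OF S] unfolding Q_def by blast
  show "Q \<noteq> {0}" using QR nonzero ideal_inD(2)[OF singular_primeD(3)[OF S]] by blast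
  show "localization ?C Q = V"
  proof
    show "localization ?C Q \<subseteq> V"
    proof
      fix x assume "x \<in> localization ?C Q"
      then obtain a s where x: "x = a / s" "a \<in> ?C" "s \<in> ?C" "s \<notin> local_maximal"
        unfolding localization_def Q_def by blast
      then have "a * (1 / s) \<in> V"
        using unit_outside_local_maximal(2)[of s] CV by (intro loc.mult) blast+
      then show "x \<in> V" by (simp add: x(1))
    qed
    show "V \<subseteq> localization ?C Q"
      using RC QR unfolding localization_def by blast
  qed
qed

text \<open>A singular prime \<open>Q'\<close> of the component contains its conductor, hence
  \<open>1 - idem P\<close>, and so misses \<open>idem P\<close>. Its contraction is a singular
  prime of \<open>R\<close> without \<open>idem P\<close>, which must be \<open>P\<close>. Clearing
  denominators gives \<open>Q \<subseteq> Q'\<close>, and \<open>Q\<close> is maximal. That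
  \<open>Q\<close> is singular follows from the equality of the localizations.\<close>

lemma singular_primes_local_component:
  assumes S: "P \<in> singular_primes R"
  defines "Q \<equiv> subring_prime.local_maximal R P \<inter> local_component R P"
  shows "singular_primes (local_component R P) = {Q}"
proof -
  interpret order_prime R P by (rule order_prime_singular[OF S])
  let ?C = "local_component R P"
  interpret C: integer_order ?C by (rule local_component_order[OF S])
  have RC: "R \<subseteq> ?C" by (rule local_component_order[OF S])
  note Q = localization_local_component[OF S, folded Q_def]
  interpret CQ: order_prime ?C Q by unfold_locales (use Q in auto)
  have "C.cond \<subseteq> Q"
    using CQ.integers_subset_localization_iff integers_subset_localization_iff
      singular_primeD(2)[OF S] Q(3) by auto
  then have "Q \<in> singular_primes ?C" using C.singular_primes_iff Q(1) by blast
  moreover have "Q' = Q" if Q': "Q' \<in> singular_primes ?C" for Q'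
  proof -
    note Q'D = C.singular_primeD[OF Q']
    have "1 - idem P \<in> Q'"
      using complement_idem_in_conductor[OF S] C.conductor_eq Q'D(2) by blast
    have "idem P \<notin> Q'"
    proof
      assume "idem P \<in> Q'"
      then have "(1 - idem P) + idem P \<in> Q'" using \<open>1 - idem P \<in> Q'\<close> by (intro ideal_inD(3)[OF Q'D(3)])
      then show False using Q'D(4) by simp
    qed
    have "prime_in R (Q' \<inter> R)" by (rule prime_in_restrict[OF field_subring_axioms RC Q'D(1)])
    moreover have "cond \<subseteq> Q' \<inter> R"
      using conductor_mono[OF C.integer_order_axioms RC] cond_subset Q'D(2)
      unfolding conductor_eq C.conductor_eq by blast
    ultimately have "Q' \<inter> R \<in> singular_primes R" using singular_primes_iff by blast
    then have QR: "Q' \<inter> R = P" using idem(4)[OF S] \<open>idem P \<notin> Q'\<close> by blast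
    have "Q \<subseteq> Q'"
    proof
      fix x assume x: "x \<in> Q"
      then obtain s where s: "s \<in> R - P" "s * x \<in> P" using in_local_maximal_iff unfolding Q_def by blast
      then have "s \<in> ?C" "s \<notin> Q'" "s * x \<in> Q'" "x \<in> ?C" using QR RC x unfolding Q_def by blast+
      then show "x \<in> Q'" using prime_inD(3)[OF Q'D(1)] by blast
    qed
    then show ?thesis using C.nonzero_prime_maximal[OF Q(1,2) Q'D(1)] by simp
  qed
  ultimately show ?thesis by blast
qed

text \<open>The component determines its only singular prime, whose contraction to \<open>R\<close>
  is \<open>P\<close>.\<close>

lemma inj_on_local_component: "inj_on (local_component R) (singular_primes R)"
proof (rule inj_onI)
  fix P P' assume P: "P \<in> singular_primes R" "P' \<in> singular_primes R"
    and eq: "local_component R P = local_component R P'"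
  have "subring_prime.local_maximal R P \<inter> local_component R P
      = subring_prime.local_maximal R P' \<inter> local_component R P'"
    using singular_primes_local_component[OF P(1)] singular_primes_local_component[OF P(2)] eq by auto
  then show "P = P'"
    using localization_local_component(4)[OF P(1)] localization_local_component(4)[OF P(2)] by metis
qed

text \<open>The denominators of \<open>x\<close> form an ideal of \<open>R\<close> that contains the
  conductor. If it were proper, it would lie in a singular prime \<open>P\<close>, but it contains
  \<open>idem P\<close>.\<close>

lemma integer_in_order_if_locally:
  assumes x: "x \<in> \<O>\<^sub>K" and loc: "\<And>P. P \<in> singular_primes R \<Longrightarrow> idem P * x \<in> R"
  shows "x \<in> R"
proof (rule ccontr)
  assume "x \<notin> R"
  define J where "J = {r \<in> R. x * r \<in> R}"
  have "ideal_in R J" unfolding J_def by (rule ideal_colon[OF ideal_self])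
  moreover have "cond \<subseteq> J"
    using cond_subset condD[OF _ x] by (auto simp: J_def mult.commute)
  moreover have "1 \<notin> J" using \<open>x \<notin> R\<close> by (simp add: J_def)
  ultimately obtain P where P: "P \<in> singular_primes R" "J \<subseteq> P" using singular_prime_above by blast
  have "idem P \<in> J" using idem(1)[OF P(1)] loc[OF P(1)] by (simp add: J_def mult.commute)
  then show False using P(2) idem(3)[OF P(1)] by blast
qed

lemma eq_Inter_local_components:
  "R = \<O>\<^sub>K \<inter> (\<Inter>P\<in>singular_primes R. local_component R P)"
proof
  show "R \<subseteq> \<O>\<^sub>K \<inter> (\<Inter>P\<in>singular_primes R. local_component R P)"
    using subset_integers local_component_order(2) by blast
  show "\<O>\<^sub>K \<inter> (\<Inter>P\<in>singular_primes R. local_component R P) \<subseteq> R"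
    using integer_in_order_if_locally local_component_eq by fastforce
qed

end

section \<open>Intersections of orders with coprime conductors\<close>

lemma coprime_ideals_iff:
  fixes I J :: "'k::field_char_0 set"
  assumes I: "ideal_in \<O>\<^sub>K I" and J: "ideal_in \<O>\<^sub>K J"
  shows "coprime_ideals I J \<longleftrightarrow> (\<exists>a\<in>I. 1 - a \<in> J)"
proof -
  have sum: "I <+>\<^bsub>ring_on \<O>\<^sub>K\<^esub> J = {a + b | a b. a \<in> I \<and> b \<in> J}"
    by (auto simp: set_add_def set_mult_def)
  show ?thesis
  proof
    assume "coprime_ideals I J"
    then have "(1::'k) \<in> {a + b | a b. a \<in> I \<and> b \<in> J}"
      unfolding coprime_ideals_def sum using integers.one by blast
    then obtain a b where "1 = a + b" "a \<in> I" "b \<in> J" by blast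
    moreover from this have "1 - a = b" by (simp add: algebra_simps)
    ultimately show "\<exists>a\<in>I. 1 - a \<in> J" by auto
  next
    assume "\<exists>a\<in>I. 1 - a \<in> J"
    then obtain a where a: "a \<in> I" "1 - a \<in> J" by blast
    have "x \<in> {a + b | a b. a \<in> I \<and> b \<in> J}" if "x \<in> \<O>\<^sub>K" for x
    proof -
      have "x = x * a + x * (1 - a)" by (simp add: algebra_simps)
      then show ?thesis using ideal_inD(4)[OF I that a(1)] ideal_inD(4)[OF J that a(2)] by blast
    qed
    moreover have "a + b \<in> \<O>\<^sub>K" if "a \<in> I" "b \<in> J" for a b
      using that ideal_inD(1)[OF I] ideal_inD(1)[OF J] by (intro integers.add) auto
    ultimately show "coprime_ideals I J"
      unfolding coprime_ideals_def sum by blast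
  qed
qed

text \<open>Both images count the classes of the same equivalence relation on \<open>A\<close>.
  Indices are compared in this way through coset maps, without quotient groups.\<close>

lemma card_image_eq_if_same_kernel:
  assumes "\<And>x y. x \<in> A \<Longrightarrow> y \<in> A \<Longrightarrow> f x = f y \<longleftrightarrow> g x = g y"
  shows "card (f ` A) = card (g ` A)"
proof -
  define h where "h c = g (inv_into A f c)" for c
  have h: "h (f x) = g x" if "x \<in> A" for x
    unfolding h_def using that assms[of "inv_into A f (f x)" x]
    by (simp add: inv_into_into f_inv_into_f)
  have "inj_on h (f ` A)" using h assms by (auto simp: inj_on_def)
  moreover have "h ` f ` A = g ` A" using h by (simp add: image_image)
  ultimately show ?thesis by (metis card_image)
qed

lemma finite_image_if_kernel_le:
  assumes "finite (g ` A)" "\<And>x y. x \<in> A \<Longrightarrow> y \<in> A \<Longrightarrow> g x = g y \<Longrightarrow> f x = f y"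
  shows "finite (f ` A)"
proof -
  have "f x = f (inv_into A g (g x))" if "x \<in> A" for x
    using that assms(2)[of "inv_into A g (g x)" x] by (simp add: inv_into_into f_inv_into_f)
  then have "f ` A \<subseteq> (\<lambda>c. f (inv_into A g c)) ` g ` A" by blast
  then show ?thesis using assms(1) finite_surj by blast
qed

definition coset_of :: "'k::field_char_0 set \<Rightarrow> 'k \<Rightarrow> 'k set" where
  "coset_of A x = (\<lambda>a. a + x) ` A"

lemma order_index_eq: "order_index A = card (coset_of A ` \<O>\<^sub>K)"
proof -
  have "a_rcosets\<^bsub>ring_on \<O>\<^sub>K\<^esub> A = coset_of A ` \<O>\<^sub>K"
    by (auto simp: A_RCOSETS_def RCOSETS_def r_coset_def coset_of_def)
  then show ?thesis by (simp add: order_index_def)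
qed

lemma (in field_subring) coset_of_eq_iff: "coset_of R x = coset_of R y \<longleftrightarrow> x - y \<in> R"
proof
  assume eq: "coset_of R x = coset_of R y"
  have "0 + x \<in> coset_of R x" unfolding coset_of_def using zero by blast
  then have "0 + x \<in> (\<lambda>a. a + y) ` R" unfolding eq unfolding coset_of_def .
  then obtain a where "x = a + y" "a \<in> R" by auto
  then show "x - y \<in> R" by simp
next
  assume xy: "x - y \<in> R"
  have "a + x \<in> coset_of R y" if "a \<in> R" for a
    unfolding coset_of_def using add[OF that xy] by (intro image_eqI[of _ _ "a + (x - y)"]) auto
  moreover have "a + y \<in> coset_of R x" if "a \<in> R" for a
    unfolding coset_of_def using diff[OF that xy] by (intro image_eqI[of _ _ "a - (x - y)"]) auto
  ultimately show "coset_of R x = coset_of R y" by (auto simp: coset_of_def)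
qed

lemma order_index_Int:
  assumes A: "integer_order A" and B: "integer_order B" and AB: "field_subring (A \<inter> B)"
    and co: "coprime_ideals (conductor A) (conductor B)"
  shows "order_index (A \<inter> B) = order_index A * order_index B"
proof -
  interpret A: integer_order A by fact
  interpret B: integer_order B by fact
  interpret AB: field_subring "A \<inter> B" by fact
  obtain a where a: "a \<in> A.cond" "1 - a \<in> B.cond"
    using co unfolding A.conductor_eq B.conductor_eq
      coprime_ideals_iff[OF A.ideal_integers_cond B.ideal_integers_cond] by blast
  let ?f = "\<lambda>x. (coset_of A x, coset_of B x)"
  have "card (coset_of (A \<inter> B) ` \<O>\<^sub>K) = card (?f ` \<O>\<^sub>K)"
    by (rule card_image_eq_if_same_kernel)
      (simp add: AB.coset_of_eq_iff A.coset_of_eq_iff B.coset_of_eq_iff)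
  also have "?f ` \<O>\<^sub>K = coset_of A ` \<O>\<^sub>K \<times> coset_of B ` \<O>\<^sub>K"
  proof (intro equalityI subsetI)
    fix p assume "p \<in> coset_of A ` \<O>\<^sub>K \<times> coset_of B ` \<O>\<^sub>K"
    then obtain x y where xy: "p = (coset_of A x, coset_of B y)" "x \<in> \<O>\<^sub>K" "y \<in> \<O>\<^sub>K" by blast
    \<comment> \<open>The Chinese remainder: \<open>a\<close> is 0 modulo the conductor of
      \<open>A\<close> and 1 modulo that of \<open>B\<close>, so \<open>z\<close> agrees with
      \<open>x\<close> modulo \<open>A\<close> and with \<open>y\<close> modulo
      \<open>B\<close>.\<close>
    define z where "z = x + a * (y - x)"
    have aO: "a \<in> \<O>\<^sub>K" using a(1) A.cond_subset A.subset_integers by blast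
    have zO: "z \<in> \<O>\<^sub>K" unfolding z_def
      by (rule integers.add[OF xy(2) integers.mult[OF aO integers.diff[OF xy(3,2)]]])
    have "a * (y - x) \<in> A" by (rule A.condD[OF a(1) integers.diff[OF xy(3,2)]])
    then have 1: "coset_of A z = coset_of A x" by (simp add: A.coset_of_eq_iff z_def)
    have "(1 - a) * (x - y) \<in> B" by (rule B.condD[OF a(2) integers.diff[OF xy(2,3)]])
    moreover have "(1 - a) * (x - y) = z - y" by (simp add: z_def algebra_simps)
    ultimately have 2: "coset_of B z = coset_of B y" by (simp add: B.coset_of_eq_iff)
    show "p \<in> ?f ` \<O>\<^sub>K" using 1 2 zO xy(1) by (intro image_eqI[of _ _ z]) auto
  qed auto
  finally show ?thesis by (simp add: order_index_eq card_cartesian_product)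
qed

text \<open>\<open>v\<close> is a product of factors \<open>1 - a\<close>, one for each
  \<open>B\<close>, with \<open>a\<close> in the conductor of \<open>A\<close> and
  \<open>1 - a\<close> in that of \<open>B\<close>.\<close>

lemma coprime_to_all:
  assumes A: "integer_order A" and F: "finite F" "\<And>B. B \<in> F \<Longrightarrow> integer_order B"
    and co: "\<And>B. B \<in> F \<Longrightarrow> coprime_ideals (conductor A) (conductor B)"
  shows "\<exists>v\<in>\<O>\<^sub>K. 1 - v \<in> conductor A \<and> (\<forall>B\<in>F. v \<in> conductor B)"
  using F co
proof (induction F rule: finite_induct)
  interpret A: integer_order A by fact
  case empty
  then show ?case using ideal_inD(2)[OF A.ideal_integers_cond] A.conductor_eq
    by (intro bexI[of _ 1]) auto
next
  interpret A: integer_order A by fact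
  case (insert B F)
  then interpret B: integer_order B by simp
  obtain v where v: "v \<in> \<O>\<^sub>K" "1 - v \<in> A.cond" "\<forall>B\<in>F. v \<in> conductor B"
    using insert unfolding A.conductor_eq by auto
  have "coprime_ideals A.cond B.cond"
    using insert.prems(2)[of B] unfolding A.conductor_eq B.conductor_eq by simp
  then obtain a where a: "a \<in> A.cond" "1 - a \<in> B.cond"
    unfolding coprime_ideals_iff[OF A.ideal_integers_cond B.ideal_integers_cond] by blast
  have "1 - a \<in> \<O>\<^sub>K" using a(2) B.cond_subset B.subset_integers by blast
  then have "v * (1 - a) \<in> \<O>\<^sub>K" using v(1) by (intro integers.mult)
  moreover have "1 - v * (1 - a) \<in> A.cond"
  proof -
    have "1 - v * (1 - a) = (1 - v) + v * a" by (simp add: algebra_simps)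
    also have "\<dots> \<in> A.cond"
      by (rule ideal_inD(3)[OF A.ideal_integers_cond v(2) ideal_inD(4)[OF A.ideal_integers_cond v(1) a(1)]])
    finally show ?thesis .
  qed
  moreover have "v * (1 - a) \<in> conductor B"
    unfolding B.conductor_eq by (rule ideal_inD(4)[OF B.ideal_integers_cond v(1) a(2)])
  moreover have "v * (1 - a) \<in> conductor C" if "C \<in> F" for C
  proof -
    interpret C: integer_order C using insert.prems(1) that by simp
    show ?thesis using v(3) that \<open>1 - a \<in> \<O>\<^sub>K\<close> unfolding C.conductor_eq
      by (intro C.cond_mult_integer) (auto simp: C.conductor_eq)
  qed
  ultimately show ?case unfolding A.conductor_eq by (intro bexI[of _ "v * (1 - a)"]) auto
qed

context integer_order
begin

text \<open>As infinite sets have cardinality 0, positivity says that the index is finite.\<close>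

lemma order_index_pos: "order_index R > 0"
proof -
  obtain m :: int where m: "m \<noteq> 0" "\<And>x. x \<in> \<O>\<^sub>K \<Longrightarrow> of_int m * x \<in> R" using multiple by blast
  obtain g :: "'k \<Rightarrow> 'k \<Rightarrow> int" where g: "finite (g ` \<O>\<^sub>K)"
    "\<And>x y. x \<in> \<O>\<^sub>K \<Longrightarrow> y \<in> \<O>\<^sub>K \<Longrightarrow> g x = g y \<Longrightarrow> \<exists>z\<in>\<O>\<^sub>K. x - y = of_int m * z"
    using residues[OF m(1)] by blast
  have "finite (coset_of R ` \<O>\<^sub>K)"
  proof (rule finite_image_if_kernel_le[OF g(1)])
    fix x y :: 'k assume "x \<in> \<O>\<^sub>K" "y \<in> \<O>\<^sub>K" "g x = g y"
    then obtain z where "z \<in> \<O>\<^sub>K" "x - y = of_int m * z" using g(2) by blast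
    then show "coset_of R x = coset_of R y" using m(2) by (simp add: coset_of_eq_iff)
  qed
  moreover have "coset_of R ` \<O>\<^sub>K \<noteq> {}" using integers.one by blast
  ultimately show ?thesis by (simp add: order_index_eq card_gt_0_iff)
qed

lemma order_Inter:
  assumes F: "\<And>A. A \<in> F \<Longrightarrow> integer_order A" "\<And>A. A \<in> F \<Longrightarrow> R \<subseteq> A"
  shows "integer_order (\<O>\<^sub>K \<inter> \<Inter>F)"
proof (rule superring_order)
  have "x - y \<in> A \<and> x * y \<in> A" if "A \<in> F" "x \<in> A" "y \<in> A" for x y A
  proof -
    interpret A: integer_order A using F(1) that(1) .
    show ?thesis using that by (blast intro: A.diff A.mult)
  qed
  moreover have "1 \<in> A" if "A \<in> F" for A using F(2)[OF that] one by blast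
  ultimately show "field_subring (\<O>\<^sub>K \<inter> \<Inter>F)"
    by unfold_locales (auto intro: integers.diff integers.mult)
  show "R \<subseteq> \<O>\<^sub>K \<inter> \<Inter>F" using F(2) subset_integers by blast
qed blast

lemma conductor_Inter:
  assumes F: "\<And>A. A \<in> F \<Longrightarrow> integer_order A" "\<And>A. A \<in> F \<Longrightarrow> R \<subseteq> A"
  shows "conductor (\<O>\<^sub>K \<inter> \<Inter>F) = \<O>\<^sub>K \<inter> (\<Inter>A\<in>F. conductor A)"
proof -
  interpret D: integer_order "\<O>\<^sub>K \<inter> \<Inter>F" by (rule order_Inter[OF F])
  show ?thesis
  proof (intro equalityI subsetI)
    fix x assume x: "x \<in> conductor (\<O>\<^sub>K \<inter> \<Inter>F)"
    then have "x \<in> \<O>\<^sub>K" using D.cond_subset unfolding D.conductor_eq by blast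
    moreover have "x \<in> conductor A" if "A \<in> F" for A
      using x that unfolding D.in_conductor_iff integer_order.in_conductor_iff[OF F(1)[OF that]] by blast
    ultimately show "x \<in> \<O>\<^sub>K \<inter> (\<Inter>A\<in>F. conductor A)" by blast
  next
    fix x assume x: "x \<in> \<O>\<^sub>K \<inter> (\<Inter>A\<in>F. conductor A)"
    have "x * y \<in> \<O>\<^sub>K \<inter> \<Inter>F" if "y \<in> \<O>\<^sub>K" for y
      using x that integer_order.in_conductor_iff[OF F(1)] integers.mult[of x y] by blast
    then show "x \<in> conductor (\<O>\<^sub>K \<inter> \<Inter>F)" unfolding D.in_conductor_iff by blast
  qed
qed

text \<open>Splitting off one order \<open>A\<close>, the intersection \<open>D\<close> of the
  others has as conductor the intersection of theirs. Hence \<open>A\<close> is coprime to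
  \<open>D\<close>, the index is multiplicative, and the intersection of the two coprime conductors
  is their product. The ideal product is formed in the commutative monoid of ideals of
  \<open>\<O>\<^sub>K\<close>.\<close>

lemma coprime_intersection:
  assumes "finite F" "\<And>A. A \<in> F \<Longrightarrow> integer_order A" "\<And>A. A \<in> F \<Longrightarrow> R \<subseteq> A"
    and "pairwise (\<lambda>A B. coprime_ideals (conductor A) (conductor B)) F"
  shows "order_index (\<O>\<^sub>K \<inter> \<Inter>F) = (\<Prod>A\<in>F. order_index A) \<and>
    conductor (\<O>\<^sub>K \<inter> \<Inter>F) = (\<Otimes>\<^bsub>ideals_set (ring_on \<O>\<^sub>K)\<^esub>A\<in>F. conductor A)"
  using assms
proof (induction F rule: finite_induct)
  interpret OK: cring "ring_on (\<O>\<^sub>K :: 'k set)" by (rule integers.cring_ring_on)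
  interpret IS: comm_monoid "ideals_set (ring_on (\<O>\<^sub>K :: 'k set))"
    by (rule OK.ideals_set_is_comm_monoid)
  case empty
  have "order_index (\<O>\<^sub>K :: 'k set) = card ((\<lambda>_. ()) ` (\<O>\<^sub>K :: 'k set))"
    unfolding order_index_eq
    by (rule card_image_eq_if_same_kernel) (auto simp: integers.coset_of_eq_iff)
  also have "(\<lambda>_. ()) ` (\<O>\<^sub>K :: 'k set) = {()}" using integers.one by blast
  finally have "order_index (\<O>\<^sub>K :: 'k set) = 1" by simp
  moreover have "conductor (\<O>\<^sub>K :: 'k set) = \<O>\<^sub>K" using conductor_Inter[of "{}"] by simp
  moreover have "\<one>\<^bsub>ideals_set (ring_on \<O>\<^sub>K)\<^esub> = (\<O>\<^sub>K :: 'k set)" by (simp add: ideals_set_def)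
  ultimately show ?case by simp
next
  interpret OK: cring "ring_on (\<O>\<^sub>K :: 'k set)" by (rule integers.cring_ring_on)
  interpret IS: comm_monoid "ideals_set (ring_on (\<O>\<^sub>K :: 'k set))"
    by (rule OK.ideals_set_is_comm_monoid)
  case (insert A F)
  let ?D = "\<O>\<^sub>K \<inter> \<Inter>F"
  interpret A: integer_order A using insert.prems(1) by simp
  interpret D: integer_order ?D by (rule order_Inter) (use insert.prems in auto)
  interpret AD: integer_order "\<O>\<^sub>K \<inter> \<Inter>(insert A F)" by (rule order_Inter) (use insert.prems in auto)
  have eq: "\<O>\<^sub>K \<inter> \<Inter>(insert A F) = A \<inter> ?D" using A.subset_integers by blast
  have condD: "conductor ?D = \<O>\<^sub>K \<inter> (\<Inter>A\<in>F. conductor A)"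
    by (rule conductor_Inter) (use insert.prems in auto)
  have co: "coprime_ideals (conductor A) (conductor B)" if "B \<in> F" for B
    using insert.prems(3) insert.hyps(2) that by (auto simp: pairwise_def)
  obtain v where v: "v \<in> \<O>\<^sub>K" "1 - v \<in> conductor A" "\<forall>B\<in>F. v \<in> conductor B"
    using coprime_to_all[OF A.integer_order_axioms insert.hyps(1) _ co] insert.prems(1) by auto
  \<comment> \<open>The element \<open>1 - v\<close> of the conductor of \<open>A\<close> witnesses
    coprimality, its complement being \<open>v\<close>.\<close>
  have "1 - (1 - v) \<in> D.cond" using v(1,3) condD unfolding D.conductor_eq by simp
  then have coAD: "coprime_ideals (conductor A) (conductor ?D)"
    using v(2) unfolding A.conductor_eq D.conductor_eq
      coprime_ideals_iff[OF A.ideal_integers_cond D.ideal_integers_cond] by blast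
  have IH: "order_index ?D = (\<Prod>A\<in>F. order_index A)"
    "conductor ?D = (\<Otimes>\<^bsub>ideals_set (ring_on \<O>\<^sub>K)\<^esub>A\<in>F. conductor A)"
  proof -
    have "pairwise (\<lambda>A B. coprime_ideals (conductor A) (conductor B)) F"
      using insert.prems(3) by (auto simp: pairwise_insert)
    then show "order_index ?D = (\<Prod>A\<in>F. order_index A)"
      "conductor ?D = (\<Otimes>\<^bsub>ideals_set (ring_on \<O>\<^sub>K)\<^esub>A\<in>F. conductor A)"
      using insert.IH insert.prems(1,2) by simp_all
  qed
  have "order_index (A \<inter> ?D) = order_index A * order_index ?D"
    using order_index_Int[OF A.integer_order_axioms D.integer_order_axioms _ coAD]
      AD.field_subring_axioms unfolding eq by blast
  then have 1: "order_index (\<O>\<^sub>K \<inter> \<Inter>(insert A F)) = (\<Prod>A\<in>insert A F. order_index A)"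
    unfolding eq using insert.hyps IH(1) by simp
  have ideal: "ideal (conductor B) (ring_on \<O>\<^sub>K)" if "integer_order B" for B :: "'k set"
    unfolding integers.ideal_ring_on_iff integer_order.conductor_eq[OF that]
    by (rule integer_order.ideal_integers_cond[OF that])
  have "conductor (\<O>\<^sub>K \<inter> \<Inter>(insert A F)) = \<O>\<^sub>K \<inter> (\<Inter>B\<in>insert A F. conductor B)"
    by (rule conductor_Inter) (use insert.prems in auto)
  also have "\<dots> = conductor A \<inter> conductor ?D" unfolding condD by blast
  also have "\<dots> = ideal_prod (ring_on \<O>\<^sub>K) (conductor A) (conductor ?D)"
    using coAD unfolding coprime_ideals_def
    by (intro OK.ideal_prod_eq_inter[symmetric] ideal A.integer_order_axioms D.integer_order_axioms) simp
  also have "\<dots> = conductor A \<otimes>\<^bsub>ideals_set (ring_on \<O>\<^sub>K)\<^esub> (\<Otimes>\<^bsub>ideals_set (ring_on \<O>\<^sub>K)\<^esub>A\<in>F. conductor A)"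
    unfolding IH(2)[symmetric] by (simp add: ideals_set_def)
  also have "\<dots> = (\<Otimes>\<^bsub>ideals_set (ring_on \<O>\<^sub>K)\<^esub>A\<in>insert A F. conductor A)"
    using insert.hyps insert.prems(1) ideal
    by (intro IS.finprod_insert[symmetric]) (auto simp: ideals_set_def)
  finally show ?case using 1 by blast
qed

end

section \<open>Uniqueness of the decomposition\<close>

locale order_decomposition = integer_order R for R :: "'k::field_char_0 set" +
  fixes F :: "'k set set"
  assumes components: "\<And>A. A \<in> F \<Longrightarrow> integer_order A"
    and irreducible: "\<And>A. A \<in> F \<Longrightarrow> card (singular_primes A) = 1"
    and coprime: "pairwise (\<lambda>A B. coprime_ideals (conductor A) (conductor B)) F"
    and intersection: "R = \<O>\<^sub>K \<inter> \<Inter>F"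
begin

lemma subset_component: "A \<in> F \<Longrightarrow> R \<subseteq> A"
  using intersection by blast

lemma component_singular_prime: "A \<in> F \<Longrightarrow> \<exists>Q. singular_primes A = {Q}"
  using irreducible card_1_singletonE by metis

lemma one_notin_conductor:
  assumes "A \<in> F" shows "1 \<notin> conductor A"
proof -
  interpret A: integer_order A by (rule components[OF assms])
  obtain Q where "Q \<in> singular_primes A" using component_singular_prime[OF assms] by blast
  then show ?thesis using A.singular_primeD(2,4) A.conductor_eq by blast
qed

text \<open>All conductors contain an integer from the conductor of \<open>R\<close>, so there are
  finitely many of them. Distinct components have distinct conductors, since a conductor coprime to
  itself would contain 1.\<close>

lemma finite_components: "finite F"
proof -
  obtain m :: int where m: "m \<noteq> 0" "of_int m \<in> cond" using int_in_cond by blast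
  have "conductor ` F \<subseteq> {G. G \<subseteq> \<O>\<^sub>K \<and> (\<forall>x\<in>G. \<forall>y\<in>G. x + y \<in> G) \<and> (\<forall>z\<in>\<O>\<^sub>K. of_int m * z \<in> G)}"
  proof clarify
    fix A assume A: "A \<in> F"
    interpret A: integer_order A by (rule components[OF A])
    have I: "ideal_in \<O>\<^sub>K (conductor A)" unfolding A.conductor_eq by (rule A.ideal_integers_cond)
    have "of_int m \<in> conductor A"
      using m(2) conductor_mono[OF A.integer_order_axioms subset_component[OF A]] conductor_eq by blast
    then show "conductor A \<subseteq> \<O>\<^sub>K \<and> (\<forall>x\<in>conductor A. \<forall>y\<in>conductor A. x + y \<in> conductor A) \<and>
      (\<forall>z\<in>\<O>\<^sub>K. of_int m * z \<in> conductor A)"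
      using ideal_inD(1,3,5)[OF I] by blast
  qed
  then have "finite (conductor ` F)" using finite_subgroups[OF m(1)] finite_subset by blast
  moreover have "inj_on conductor F"
  proof (rule inj_onI, rule ccontr)
    fix A B assume AB: "A \<in> F" "B \<in> F" "conductor A = conductor B" "A \<noteq> B"
    interpret A: integer_order A by (rule components[OF AB(1)])
    have "coprime_ideals (conductor A) (conductor A)"
      using pairwiseD[OF coprime AB(1,2,4)] AB(3) by simp
    then obtain a where "a \<in> A.cond" "1 - a \<in> A.cond"
      unfolding A.conductor_eq coprime_ideals_iff[OF A.ideal_integers_cond A.ideal_integers_cond] by blast
    then have "a + (1 - a) \<in> A.cond" by (rule ideal_inD(3)[OF A.ideal_cond])
    then show False using one_notin_conductor[OF AB(1)] A.conductor_eq by simp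
  qed
  ultimately show ?thesis by (rule finite_imageD)
qed

text \<open>The element \<open>v\<close>, which is 1 modulo the conductor of \<open>A\<close> and
  lies in all the others, maps \<open>A\<close> into every component and hence into
  \<open>R\<close>. It lies outside \<open>Q\<close>, so it is a denominator at \<open>P\<close> for
  all of \<open>A\<close>. In the other direction, the denominators in \<open>A\<close> of some
  \<open>x\<close> outside \<open>A\<close> would form an ideal inside \<open>Q\<close>, the only
  singular prime of \<open>A\<close>, although \<open>s\<close> is one of them.\<close>

lemma component_is_local:
  assumes A: "A \<in> F"
  shows "\<exists>P\<in>singular_primes R. A = local_component R P"
proof -
  interpret A: integer_order A by (rule components[OF A])
  have RA: "R \<subseteq> A" by (rule subset_component[OF A])
  obtain Q where Q: "singular_primes A = {Q}" using component_singular_prime[OF A] by blast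
  then have QS: "Q \<in> singular_primes A" by blast
  note QD = A.singular_primeD[OF QS]
  define P where "P = Q \<inter> R"
  have "prime_in R P" unfolding P_def by (rule prime_in_restrict[OF field_subring_axioms RA QD(1)])
  moreover have "cond \<subseteq> P"
    using conductor_mono[OF A.integer_order_axioms RA] QD(2) cond_subset
    unfolding conductor_eq A.conductor_eq P_def by blast
  ultimately have PS: "P \<in> singular_primes R" using singular_primes_iff by blast
  interpret P: order_prime R P by (rule order_prime_singular[OF PS])
  have co: "coprime_ideals (conductor A) (conductor B)" if "B \<in> F - {A}" for B
    using coprime A that by (auto simp: pairwise_def)
  obtain v where v: "v \<in> \<O>\<^sub>K" "1 - v \<in> conductor A" "\<forall>B\<in>F - {A}. v \<in> conductor B"
    using coprime_to_all[OF A.integer_order_axioms, of "F - {A}"] co finite_components components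
    by auto
  have vA: "v * x \<in> R" if "x \<in> A" for x
  proof -
    have xO: "x \<in> \<O>\<^sub>K" using that A.subset_integers by blast
    have "v = 1 - (1 - v)" by simp
    then have "v \<in> A" using v(2) A.conductor_eq A.cond_subset A.diff[OF A.one] by (metis subsetD)
    then have "v * x \<in> A" using that by (rule A.mult)
    moreover have "v * x \<in> B" if "B \<in> F - {A}" for B
      using v(3) that xO integer_order.in_conductor_iff[OF components[of B]] by blast
    moreover have "v * x \<in> \<O>\<^sub>K" using v(1) xO by (rule integers.mult)
    ultimately show ?thesis using intersection by blast
  qed
  have vR: "v \<in> R" using vA[OF A.one] by simp
  have "v \<notin> Q"
  proof
    assume "v \<in> Q"
    moreover have "1 - v \<in> Q" using v(2) QD(2) A.conductor_eq by blast
    ultimately have "v + (1 - v) \<in> Q" by (rule ideal_inD(3)[OF QD(3)])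
    then show False using QD(4) by simp
  qed
  have "A = local_component R P"
  proof (intro equalityI subsetI)
    fix x assume x: "x \<in> A"
    then have "\<exists>s\<in>R - P. s * x \<in> R" using vA vR \<open>v \<notin> Q\<close> unfolding P_def by blast
    then show "x \<in> local_component R P"
      using x A.subset_integers unfolding local_component_def P.in_localization_iff[symmetric] by blast
  next
    fix x assume "x \<in> local_component R P"
    then obtain s where s: "s \<in> R" "s \<notin> P" "s * x \<in> R" and xO: "x \<in> \<O>\<^sub>K"
      unfolding local_component_def Int_iff P.in_localization_iff by blast
    define J where "J = {r \<in> A. x * r \<in> A}"
    show "x \<in> A"
    proof (rule ccontr)
      assume "x \<notin> A"
      then have "1 \<notin> J" by (simp add: J_def)
      moreover have "ideal_in A J" unfolding J_def by (rule A.ideal_colon[OF A.ideal_self])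
      moreover have "A.cond \<subseteq> J"
        using A.cond_subset A.condD[OF _ xO] by (auto simp: J_def mult.commute)
      ultimately have "J \<subseteq> Q" using A.singular_prime_above[of J] Q by blast
      moreover have "s \<in> J" using s RA by (auto simp: J_def mult.commute)
      ultimately show False using s unfolding P_def by blast
    qed
  qed
  then show ?thesis using PS by blast
qed

text \<open>If it were missing, every component would belong to some \<open>P' \<noteq> P\<close>.
  Orthogonality then puts \<open>idem P * \<O>\<^sub>K\<close> into each component and so into
  \<open>R\<close>, which places \<open>idem P\<close> in the conductor and hence in
  \<open>P\<close>.\<close>

lemma local_component_is_component:
  assumes P: "P \<in> singular_primes R"
  shows "local_component R P \<in> F"
proof (rule ccontr)
  assume notin: "local_component R P \<notin> F"
  have "idem P * y \<in> R" if y: "y \<in> \<O>\<^sub>K" for y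
  proof -
    have "idem P \<in> \<O>\<^sub>K" using idem(1)[OF P] subset_integers by blast
    then have O: "idem P * y \<in> \<O>\<^sub>K" using y by (rule integers.mult)
    have "idem P * y \<in> A" if A: "A \<in> F" for A
    proof -
      obtain P' where P': "P' \<in> singular_primes R" "A = local_component R P'"
        using component_is_local[OF A] by blast
      then have "P' \<noteq> P" using notin A by blast
      then have "idem P' * idem P * y \<in> R"
        using condD[OF idem_orthogonal[OF P'(1) P] y] by blast
      then show ?thesis using O unfolding P'(2) local_component_eq[OF P'(1)] by (simp add: mult.assoc)
    qed
    then show ?thesis using intersection O by blast
  qed
  then have "idem P \<in> cond" unfolding cond_def by blast
  then show False using idem(3)[OF P] singular_primeD(2)[OF P] by blast
qed

lemma components_eq: "F = local_component R ` singular_primes R"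
  using component_is_local local_component_is_component by blast

end

context integer_order
begin

lemma order_decomposition_local_components:
  "order_decomposition R (local_component R ` singular_primes R)"
proof (intro order_decomposition.intro order_decomposition_axioms.intro integer_order_axioms)
  show "integer_order A" if "A \<in> local_component R ` singular_primes R" for A
    using that local_component_order(1) by blast
  show "card (singular_primes A) = 1" if "A \<in> local_component R ` singular_primes R" for A
    using that singular_primes_local_component by auto
  show "R = \<O>\<^sub>K \<inter> \<Inter>(local_component R ` singular_primes R)"
    by (rule eq_Inter_local_components)
  show "pairwise (\<lambda>A B. coprime_ideals (conductor A) (conductor B)) (local_component R ` singular_primes R)"
  proof (rule pairwiseI, clarify)
    fix P P' assume P: "P \<in> singular_primes R" "P' \<in> singular_primes R"
      and "local_component R P \<noteq> local_component R P'"
    then have "P \<noteq> P'" by blast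
    interpret C: integer_order "local_component R P" by (rule local_component_order[OF P(1)])
    interpret C': integer_order "local_component R P'" by (rule local_component_order[OF P(2)])
    let ?e = "idem P" and ?f = "idem P'"
    have 1: "1 - ?e \<in> C.cond" "1 - ?f \<in> C'.cond"
      using complement_idem_in_conductor[OF P(1)] complement_idem_in_conductor[OF P(2)]
      unfolding C.conductor_eq C'.conductor_eq by blast+
    have "?e * ?f \<in> C'.cond"
      using idem_orthogonal[OF P \<open>P \<noteq> P'\<close>]
        conductor_mono[OF C'.integer_order_axioms local_component_order(2)[OF P(2)]]
      unfolding conductor_eq C'.conductor_eq by blast
    moreover have "?e \<in> \<O>\<^sub>K" using idem(1)[OF P(1)] subset_integers by blast
    \<comment> \<open>With \<open>e\<close> and \<open>f\<close> for the two idempotents,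
      \<open>e = e * (1 - f) + e * f\<close> lies in the second conductor. So \<open>1 - e\<close>
      in the first conductor, with complement \<open>e\<close>, witnesses coprimality.\<close>
    ultimately have "?e * (1 - ?f) + ?e * ?f \<in> C'.cond"
      using ideal_inD(3,4)[OF C'.ideal_integers_cond] 1(2) by blast
    then have "1 - (1 - ?e) \<in> C'.cond" by (simp add: algebra_simps)
    then show "coprime_ideals (conductor (local_component R P)) (conductor (local_component R P'))"
      unfolding C.conductor_eq C'.conductor_eq
        coprime_ideals_iff[OF C.ideal_integers_cond C'.ideal_integers_cond]
      using 1(1) by blast
  qed
qed

end

section \<open>Orders of a number field\<close>

lemma subring_ring_on_UNIV_iff: "subring R (ring_on UNIV) \<longleftrightarrow> field_subring R"
proof
  interpret U: field_subring UNIV by unfold_locales auto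
  interpret cring "ring_on UNIV" by (rule U.cring_ring_on)
  have minus: "\<ominus>\<^bsub>ring_on UNIV\<^esub> x = - x" for x by (intro minus_equality) auto
  {
    assume R: "subring R (ring_on UNIV)"
    have "x - y \<in> R" if "x \<in> R" "y \<in> R" for x y
      using subringE(7)[OF R that(1) subringE(5)[OF R that(2)]] by (simp add: minus)
    then show "field_subring R"
      using subringE(3,6)[OF R] by unfold_locales auto
  }
  {
    assume "field_subring R"
    then interpret field_subring R .
    show "subring R (ring_on UNIV)"
      by (rule subringI) (auto simp: minus)
  }
qed

lemma is_order_iff:
  fixes R :: "'k::field_char_0 set"
  assumes "number_field TYPE('k)"
  shows "is_order R \<longleftrightarrow> field_subring R \<and> R \<subseteq> \<O>\<^sub>K \<and> (\<exists>B\<subseteq>R. rat_basis B)"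
  unfolding is_order_def subring_ring_on_UNIV_iff int_rank_eq_field_degree_iff[OF assms] ..

lemma is_order_imp_integer_order:
  fixes R :: "'k::field_char_0 set"
  assumes "number_field TYPE('k)" "is_order R"
  shows "integer_order R"
proof -
  obtain B where R: "field_subring R" "R \<subseteq> \<O>\<^sub>K" and B: "B \<subseteq> R" "rat_basis B"
    using assms(2) unfolding is_order_iff[OF assms(1)] by metis
  interpret field_subring R by fact
  have BO: "B \<subseteq> \<O>\<^sub>K" using B(1) R(2) by blast
  show ?thesis
  proof
    show "R \<subseteq> \<O>\<^sub>K" by fact
    show "\<exists>m::int. m \<noteq> 0 \<and> (\<forall>x\<in>\<O>\<^sub>K. of_int m * x \<in> R)"
      using ring_of_integers_multiple_in_int_span[OF B(2) BO] int_span_subset[OF B(1)] by blast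
    show "\<exists>g :: 'k \<Rightarrow> 'k \<Rightarrow> int. finite (g ` \<O>\<^sub>K) \<and>
      (\<forall>x\<in>\<O>\<^sub>K. \<forall>y\<in>\<O>\<^sub>K. g x = g y \<longrightarrow> (\<exists>z\<in>\<O>\<^sub>K. x - y = of_int N * z))" if "N \<noteq> 0" for N :: int
      using finite_residues_ring_of_integers[OF B(2) BO that] by metis
  qed
qed

text \<open>The components of an abstract decomposition contain \<open>R\<close> and with it a
  rational basis, so they have full rank and are orders again.\<close>

lemma irreducible_decomposition_iff:
  fixes R :: "'k::field_char_0 set"
  assumes K: "number_field TYPE('k)" and R: "is_order R"
  shows "irreducible_decomposition R F \<longleftrightarrow> order_decomposition R F"
proof
  assume "irreducible_decomposition R F"
  then show "order_decomposition R F"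
    using is_order_imp_integer_order[OF K]
    by (intro order_decomposition.intro order_decomposition_axioms.intro is_order_imp_integer_order[OF K R])
      (auto simp: irreducible_decomposition_def irreducible_order_def)
next
  assume "order_decomposition R F"
  then interpret order_decomposition R F .
  have "is_order A" if A: "A \<in> F" for A
  proof -
    interpret A: integer_order A by (rule components[OF A])
    show ?thesis
      using subset_component[OF A] R A.subset_integers A.field_subring_axioms
      unfolding is_order_iff[OF K] by (meson order_trans)
  qed
  then show "irreducible_decomposition R F"
    using irreducible coprime intersection
    unfolding irreducible_decomposition_def irreducible_order_def by blast
qed

text \<open>Finiteness of \<open>F\<close> and positivity of the index keep the product formulas
  from speaking of default values: a product over an infinite family would be the unit, and an
  infinite index would count as 0. Injectivity says that the intersection over the singular primes
  lists each component once.\<close>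

theorem theorem6:
  fixes R :: "'k::field_char_0 set"
  assumes "number_field TYPE('k)"
    and "is_order R"
  shows "(\<exists>!F. irreducible_decomposition R F) \<and>
    (\<forall>F. irreducible_decomposition R F \<longrightarrow>
       finite F \<and>
       order_index R > 0 \<and>
       order_index R = (\<Prod>A\<in>F. order_index A) \<and>
       conductor R = (\<Otimes>\<^bsub>ideals_set (ring_on \<O>\<^sub>K)\<^esub>A\<in>F. conductor A)) \<and>
    irreducible_decomposition R (local_component R ` singular_primes R) \<and>
    inj_on (local_component R) (singular_primes R) \<and>
    R = \<O>\<^sub>K \<inter> (\<Inter>P\<in>singular_primes R. localization R P \<inter> \<O>\<^sub>K) \<and>
    (\<forall>P\<in>singular_primes R.
       \<exists>Q. singular_primes (local_component R P) = {Q} \<and>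
           localization R P = localization (local_component R P) Q)"
proof -
  note iff = irreducible_decomposition_iff[OF assms]
  interpret integer_order R by (rule is_order_imp_integer_order[OF assms])
  have dec: "irreducible_decomposition R (local_component R ` singular_primes R)"
    unfolding iff by (rule order_decomposition_local_components)
  moreover have "F = local_component R ` singular_primes R" if "irreducible_decomposition R F" for F
    using that unfolding iff by (rule order_decomposition.components_eq)
  ultimately have unique: "\<exists>!F. irreducible_decomposition R F" by blast
  have invariants: "finite F \<and> order_index R > 0 \<and> order_index R = (\<Prod>A\<in>F. order_index A) \<and>
      conductor R = (\<Otimes>\<^bsub>ideals_set (ring_on \<O>\<^sub>K)\<^esub>A\<in>F. conductor A)"
    if "irreducible_decomposition R F" for F
  proof -
    interpret order_decomposition R F using that unfolding iff .
    show ?thesis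
      using finite_components order_index_pos
        coprime_intersection[OF finite_components components subset_component coprime]
      unfolding intersection[symmetric] by blast
  qed
  have components: "\<exists>Q. singular_primes (local_component R P) = {Q} \<and>
      localization R P = localization (local_component R P) Q" if "P \<in> singular_primes R" for P
    using singular_primes_local_component[OF that] localization_local_component(3)[OF that] by metis
  show ?thesis
    using unique invariants dec inj_on_local_component components
      eq_Inter_local_components[unfolded local_component_def]
    by blast
qed

end
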